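(* Let $p>7$ be a prime and let $P$ be a partial latin square of order $p$ of the form \[ P=\{(i,c+i,s+i),\ (i,c'+i,s'+i),\ (i,c''+i,s''+i)\mid 0\le i<p\} \] for some distinct $c,c',c''$ and some distinct $s,s',s''$ (all arithmetic mod $p$). Then $P$ can be completed to a diagonally cyclic latin square of order $p$.
   Context: Triples $(r,t,u)$ denote symbol $u$ in row $r$, column $t$, with rows, columns and symbols in $\{0,\dots,p-1\}$. A latin square with operation $\circ$ of odd order $n$ is diagonally cyclic if $i\circ j=k$ implies $(i+1)\circ(j+1)=k+1$ for all cells. Completing $P$ means finding a latin square containing $P$ as a set of triples. *)

theory Defs
  imports "HOL-Computational_Algebra.Primes"
begin

text \<open>Triples (r,t,u): symbol u in row r, column t; all entries in {0..<n}.\<close>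

definition partial_latin_square :: "nat \<Rightarrow> (nat \<times> nat \<times> nat) set \<Rightarrow> bool" where
  "partial_latin_square n P \<longleftrightarrow>
     P \<subseteq> {..<n} \<times> {..<n} \<times> {..<n} \<and>
     (\<forall>(r,t,u)\<in>P. \<forall>(r',t',u')\<in>P.
        (r = r' \<and> t = t' \<longrightarrow> u = u') \<and>
        (r = r' \<and> u = u' \<longrightarrow> t = t') \<and>
        (t = t' \<and> u = u' \<longrightarrow> r = r'))"

definition latin_square :: "nat \<Rightarrow> (nat \<times> nat \<times> nat) set \<Rightarrow> bool" where
  "latin_square n L \<longleftrightarrow> partial_latin_square n L \<and>
     (\<forall>r<n. \<forall>t<n. \<exists>u. (r,t,u) \<in> L)"

definition diagonally_cyclic :: "nat \<Rightarrow> (nat \<times> nat \<times> nat) set \<Rightarrow> bool" where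
  "diagonally_cyclic n L \<longleftrightarrow>
     (\<forall>(i,j,k)\<in>L. ((i+1) mod n, (j+1) mod n, (k+1) mod n) \<in> L)"

end

theory Submission
  imports Defs
    "Berlekamp_Zassenhaus.Finite_Field"
    "HOL-Computational_Algebra.Polynomial_Factorial"
begin

text \<open>
  A diagonally cyclic latin square of order \<open>p\<close> is the same as an orthomorphism of \<open>\<int>/p\<close>, that is, a
  map \<open>f\<close> for which \<open>f\<close> and \<open>x \<mapsto> f x - x\<close> are bijective: cell \<open>(i, i + d)\<close> contains \<open>i + f d\<close>. So we need
  an orthomorphism through three given points \<open>A, B, C\<close> no two of which share \<open>x\<close>, \<open>y\<close> or \<open>y - x\<close>. If
  they are collinear a linear map does it. Otherwise let \<open>a, b, c\<close> be the slopes of \<open>BC, CA, AB\<close>; up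
  to translation and scaling the triangle is determined by them. The map with slope \<open>s\<close> on the
  nonzero squares and slope \<open>c\<close> elsewhere is an orthomorphism when \<open>s/c\<close> and \<open>(s-1)/(c-1)\<close> are
  squares, and it contains such a triangle, with \<open>A, B\<close> on the line of slope \<open>c\<close> through the origin,
  as soon as \<open>(s-a)/(c-a)\<close> and \<open>(s-b)/(c-b)\<close> are non-squares.

  For \<open>p \<ge> 149\<close> such an \<open>s\<close> exists because the character sums that count the solutions involve only
  products of at most four linear factors, and Hasse's bound \<open>2 \<surd>p\<close> applies to them. Hasse's bound
  is proved by Manin's elementary method: on the twist \<open>f(t) Y\<^sup>2 = f(X)\<close> over \<open>F\<^sub>p(t)\<close> the heights of the
  points \<open>(t\<^sup>p, f(t)\<^bsup>(p-1)/2\<^esup>) + n (t, \<plusminus>1)\<close> form a quadratic polynomial in \<open>n\<close>, which is never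
  negative. For the primes below 149 the existence of \<open>s\<close> (for one of the three choices of the
  distinguished slope, and up to the symmetries \<open>m \<mapsto> 1 - m\<close>, \<open>m \<mapsto> 1/m\<close> of the slopes) is checked by
  evaluation, except for a few triples with \<open>p \<le> 41\<close>, for which an orthomorphism is given explicitly.
\<close>

section \<open>Heights of rational functions\<close>

definition reduced :: "'a::field_gcd poly fract \<Rightarrow> 'a poly \<Rightarrow> 'a poly \<Rightarrow> bool" where
  "reduced X A B \<longleftrightarrow> coprime A B \<and> B \<noteq> 0 \<and> X = to_fract A / to_fract B"

definition height :: "'a::field_gcd poly fract \<Rightarrow> nat" where
  "height X = max (degree (fst (quot_of_fract X))) (degree (snd (quot_of_fract X)))"

lemma reduced_quot_of_fract: "reduced X (fst (quot_of_fract X)) (snd (quot_of_fract X))"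
  unfolding reduced_def using coprime_quot_of_fract[of X] Fract_quot_of_fract[of X]
  by (auto simp: Fract_conv_to_fract[symmetric])

lemma to_fract_power [simp]: "to_fract (P ^ n) = to_fract P ^ n"
  by (induction n) auto

lemma to_fract_numeral [simp]: "to_fract (numeral n) = numeral n"
  by (metis of_nat_numeral of_nat_fract Fract_conv_to_fract div_by_1 to_fract_1)

lemma is_unit_if_no_prime_dvd:
  fixes a :: "'a::factorial_semiring"
  assumes "a \<noteq> 0" and "\<And>q. prime_elem q \<Longrightarrow> \<not> q dvd a"
  shows "is_unit a"
  using assms prime_divisor_exists[of a] by auto

lemma coprime_if_no_prime_dvd:
  fixes a b :: "'a::{factorial_semiring,semiring_gcd}"
  assumes "b \<noteq> 0" and "\<And>q. prime_elem q \<Longrightarrow> q dvd a \<Longrightarrow> \<not> q dvd b"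
  shows "coprime a b"
  using assms is_unit_if_no_prime_dvd[of "gcd a b"] is_unit_gcd by auto

lemma coeff_mult_degree_bounds:
  assumes "degree P \<le> m" "degree Q \<le> n"
  shows "coeff (P * Q) (m + n) = coeff P m * coeff Q n"
proof -
  have "coeff P i * coeff Q (m + n - i) = 0" if "i \<in> {..m + n} - {m}" for i
  proof -
    have "degree P < i \<or> degree Q < m + n - i" using that assms by auto
    then show ?thesis by (auto simp: coeff_eq_0)
  qed
  then have "coeff (P * Q) (m + n) = (\<Sum>i\<in>{m}. coeff P i * coeff Q (m + n - i))"
    unfolding coeff_mult by (intro sum.mono_neutral_right) auto
  then show ?thesis by simp
qed

lemma coeff_max_degree_nonzero:
  assumes "A \<noteq> 0 \<or> B \<noteq> 0"
  shows "coeff A (max (degree A) (degree B)) \<noteq> 0 \<or> coeff B (max (degree A) (degree B)) \<noteq> 0"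
proof (cases "degree A \<le> degree B")
  case True
  then show ?thesis using assms leading_coeff_0_iff[of A] by (cases "B = 0") (auto simp: max_def)
next
  case False
  then show ?thesis by (auto simp: max_def)
qed

text \<open>
  The three polynomials are the coefficients of \<open>(B1 z + A1) (B2 z + A2)\<close>: the maximal degree of the
  coefficients is additive under multiplication.
\<close>

lemma max_degree_mult:
  fixes A1 A2 B1 B2 :: "'a::idom poly"
  assumes "A1 \<noteq> 0 \<or> B1 \<noteq> 0" "A2 \<noteq> 0 \<or> B2 \<noteq> 0"
  shows "max (degree (A1 * A2)) (max (degree (A1 * B2 + A2 * B1)) (degree (B1 * B2)))
    = max (degree A1) (degree B1) + max (degree A2) (degree B2)" (is "?L = ?m + ?n")
proof (rule antisym)
  have deg: "degree A1 \<le> ?m" "degree B1 \<le> ?m" "degree A2 \<le> ?n" "degree B2 \<le> ?n" by auto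
  have "degree (P * Q) \<le> ?m + ?n" if "degree P \<le> ?m" "degree Q \<le> ?n" for P Q :: "'a poly"
    using that degree_mult_le[of P Q] by linarith
  from this[OF deg(1,3)] this[OF deg(1,4)] this[OF deg(2,3)] this[OF deg(2,4)]
  show "?L \<le> ?m + ?n" by (simp add: degree_add_le mult.commute[of A2])
  have "coeff (A1 * A2) (?m + ?n) \<noteq> 0 \<or> coeff (A1 * B2 + A2 * B1) (?m + ?n) \<noteq> 0
    \<or> coeff (B1 * B2) (?m + ?n) \<noteq> 0"
    using coeff_max_degree_nonzero[OF assms(1)] coeff_max_degree_nonzero[OF assms(2)]
    by (auto simp: coeff_mult_degree_bounds deg mult.commute[of A2])
  then show "?m + ?n \<le> ?L" by (metis le_degree le_max_iff_disj)
qed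

lemma gcd_eq_1_if_no_prime_dvd:
  fixes a b c :: "'a::{factorial_semiring,semiring_gcd}"
  assumes "c \<noteq> 0" and "\<And>q. prime_elem q \<Longrightarrow> q dvd a \<Longrightarrow> q dvd b \<Longrightarrow> \<not> q dvd c"
  shows "gcd a (gcd b c) = 1"
proof -
  have "is_unit (gcd a (gcd b c))"
    by (rule is_unit_if_no_prime_dvd) (use assms in auto)
  then show ?thesis by simp
qed

lemma content_pCons: "content (pCons a P) = gcd a (content P)"
  by (simp add: content_def cCons_def)

lemma degree_eq_if_mult_eq_mult:
  fixes P Q V W :: "'a::idom poly"
  assumes "W * P = V * Q" "degree W = degree V" "V \<noteq> 0" "W \<noteq> 0"
  shows "degree P = degree Q"
proof (cases "P = 0 \<or> Q = 0")
  case True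
  then show ?thesis using assms by auto
next
  case False
  then have "degree W + degree P = degree V + degree Q"
    using assms degree_mult_eq by metis
  then show ?thesis using assms(2) by simp
qed

text \<open>Gauss's lemma for the quadratic \<open>W z\<^sup>2 - V z + U\<close>.\<close>

lemma height_add_height_roots:
  fixes U V W :: "'a::field_gcd poly"
  assumes "W \<noteq> 0" and primitive: "gcd U (gcd V W) = 1"
    and mult: "X1 * X2 * to_fract W = to_fract U" and add: "(X1 + X2) * to_fract W = to_fract V"
  shows "height X1 + height X2 = max (degree U) (max (degree V) (degree W))"
proof -
  obtain A1 B1 A2 B2 where
    AB: "A1 = fst (quot_of_fract X1)" "B1 = snd (quot_of_fract X1)"
      "A2 = fst (quot_of_fract X2)" "B2 = snd (quot_of_fract X2)" by blast
  have "reduced X1 A1 B1" "reduced X2 A2 B2" unfolding AB by (rule reduced_quot_of_fract)+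
  then have coprime: "coprime A1 B1" "coprime A2 B2" and nonzero: "B1 \<noteq> 0" "B2 \<noteq> 0"
    and X: "X1 = to_fract A1 / to_fract B1" "X2 = to_fract A2 / to_fract B2"
    unfolding reduced_def by auto
  have "to_fract (W * (A1 * A2)) = to_fract (B1 * B2 * U)"
    "to_fract (W * (A1 * B2 + A2 * B1)) = to_fract (B1 * B2 * V)"
    using mult add nonzero unfolding X by (simp_all add: field_simps)
  then have eq: "W * (A1 * A2) = B1 * B2 * U" "W * (A1 * B2 + A2 * B1) = B1 * B2 * V"
    unfolding to_fract_eq_iff .
  have "content [:A1, B1:] = 1" "content [:A2, B2:] = 1"
    using coprime by (simp_all add: content_pCons coprime_iff_gcd_eq_1)
  then have "content ([:A1, B1:] * [:A2, B2:]) = 1" by (simp only: content_mult mult_1)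
  moreover have primitive_content: "content [:U, V, W:] = 1"
    using primitive by (simp add: content_pCons)
  moreover have "smult W ([:A1, B1:] * [:A2, B2:]) = smult (B1 * B2) [:U, V, W:]"
    using eq by (simp add: algebra_simps)
  ultimately have "normalize W = normalize (B1 * B2)"
    using primitive_content by (metis content_smult mult.right_neutral)
  then have "degree W = degree (B1 * B2)"
    by (metis dvd_imp_degree_le associated_iff_dvd nonzero \<open>W \<noteq> 0\<close> mult_eq_0_iff order_antisym)
  then have "max (degree U) (max (degree V) (degree W))
    = max (degree (A1 * A2)) (max (degree (A1 * B2 + A2 * B1)) (degree (B1 * B2)))"
    using degree_eq_if_mult_eq_mult[OF eq(1)] degree_eq_if_mult_eq_mult[OF eq(2)] nonzero \<open>W \<noteq> 0\<close>
    by simp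
  also have "\<dots> = max (degree A1) (degree B1) + max (degree A2) (degree B2)"
    using nonzero by (intro max_degree_mult) auto
  finally show ?thesis unfolding height_def AB by simp
qed

lemma height_eq_max_degree:
  assumes "reduced X A B"
  shows "height X = max (degree A) (degree B)"
proof -
  have "gcd 0 (gcd A B) = 1" using assms unfolding reduced_def by simp
  then have "height X + height (0 :: 'a poly fract)
      = max (degree (0 :: 'a poly)) (max (degree A) (degree B))"
    using assms unfolding reduced_def by (intro height_add_height_roots) auto
  then show ?thesis by (simp add: height_def)
qed

section \<open>Hasse's bound\<close>

text \<open>
  Addition of the base point \<open>(t, \<epsilon>)\<close> on the curve \<open>twist Y\<^sup>2 = X\<^sup>3 + a2 X\<^sup>2 + a4 X\<close>. Only the chord
  formulas are used, never the associativity of the group law.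
\<close>

locale twisted_cubic =
  fixes a2 a4 t \<epsilon> :: "'k::field"
  assumes sign_square: "\<epsilon>^2 = 1"
begin

definition twist :: 'k where
  "twist = t^3 + a2 * t^2 + a4 * t"

definition on_curve :: "'k \<times> 'k \<Rightarrow> bool" where
  "on_curve P \<longleftrightarrow> twist * snd P^2 = fst P^3 + a2 * fst P^2 + a4 * fst P"

definition chord_slope :: "'k \<times> 'k \<Rightarrow> 'k" where
  "chord_slope P = (snd P - \<epsilon>) / (fst P - t)"

definition chord_abscissa :: "'k \<Rightarrow> 'k \<times> 'k \<Rightarrow> 'k" where
  "chord_abscissa \<delta> P = twist * ((snd P - \<delta>) / (fst P - t))^2 - a2 - fst P - t"

definition add_base :: "'k \<times> 'k \<Rightarrow> 'k \<times> 'k" where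
  "add_base P = (chord_abscissa \<epsilon> P, - (\<epsilon> + chord_slope P * (chord_abscissa \<epsilon> P - t)))"

lemma fst_add_base: "fst (add_base P) = twist * chord_slope P^2 - a2 - fst P - t"
  by (simp add: add_base_def chord_abscissa_def chord_slope_def)

lemma snd_add_base: "snd (add_base P) = - (\<epsilon> + chord_slope P * (fst (add_base P) - t))"
  by (simp add: add_base_def)

lemma chord_abscissa_mult_square:
  assumes "on_curve (X, Y)" "\<delta>^2 = 1" "X \<noteq> t"
  shows "chord_abscissa \<delta> (X, Y) * (X - t)^2
    = (X * t + a4) * (X + t) + 2 * a2 * X * t - 2 * twist * \<delta> * Y"
proof -
  have curve: "twist * Y^2 = X^3 + a2 * X^2 + a4 * X" using assms(1) by (simp add: on_curve_def)
  have "chord_abscissa \<delta> (X, Y) * (X - t)^2 = twist * (Y - \<delta>)^2 - (a2 + X + t) * (X - t)^2"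
    unfolding chord_abscissa_def using assms(3)
    by (simp add: power_divide left_diff_distrib algebra_simps)
  also have "\<dots> = twist * Y^2 + twist * \<delta>^2 - 2 * twist * \<delta> * Y - (a2 + X + t) * (X - t)^2"
    by Groebner_Basis.algebra
  also have "\<dots> = (X * t + a4) * (X + t) + 2 * a2 * X * t - 2 * twist * \<delta> * Y"
    unfolding curve assms(2) unfolding twist_def by Groebner_Basis.algebra
  finally show ?thesis .
qed

lemma chord_abscissa_add:
  assumes "on_curve (X, Y)" "X \<noteq> t"
  shows "(chord_abscissa \<epsilon> (X, Y) + chord_abscissa (-\<epsilon>) (X, Y)) * (X - t)^2
    = 2 * ((X * t + a4) * (X + t) + 2 * a2 * X * t)"
  using chord_abscissa_mult_square[OF assms(1) _ assms(2), of \<epsilon>]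
    chord_abscissa_mult_square[OF assms(1) _ assms(2), of "-\<epsilon>"] sign_square
  by (simp add: distrib_right)

lemma chord_abscissa_mult:
  assumes "on_curve (X, Y)" "X \<noteq> t"
  shows "chord_abscissa \<epsilon> (X, Y) * chord_abscissa (-\<epsilon>) (X, Y) * (X - t)^2 = (X * t - a4)^2"
    (is "?x1 * ?x2 * _ = _")
proof -
  define G where "G = (X * t + a4) * (X + t) + 2 * a2 * X * t"
  have curve: "twist * Y^2 = X^3 + a2 * X^2 + a4 * X" using assms(1) by (simp add: on_curve_def)
  have "?x1 * (X - t)^2 = G - 2 * twist * \<epsilon> * Y" "?x2 * (X - t)^2 = G + 2 * twist * \<epsilon> * Y"
    using assms sign_square by (simp_all add: chord_abscissa_mult_square G_def)
  then have "(?x1 * ?x2 * (X - t)^2) * (X - t)^2 = G^2 - 4 * twist * (twist * Y^2) * \<epsilon>^2"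
    by Groebner_Basis.algebra
  also have "\<dots> = (X * t - a4)^2 * (X - t)^2"
    unfolding curve sign_square unfolding G_def twist_def by Groebner_Basis.algebra
  finally show ?thesis using assms(2) by simp
qed

lemma chord_slope_mult:
  assumes "on_curve P" "fst P \<noteq> t"
  shows "twist * chord_slope P * (2 * \<epsilon> + chord_slope P * (fst P - t))
    = fst P^2 + fst P * t + t^2 + a2 * (fst P + t) + a4"
proof -
  obtain X Y where P: "P = (X, Y)" by (cases P)
  define m where "m = chord_slope P"
  have Y: "m * (X - t) = Y - \<epsilon>" unfolding m_def chord_slope_def using assms(2) P by simp
  have curve: "twist * Y^2 = X^3 + a2 * X^2 + a4 * X" using assms(1) P by (simp add: on_curve_def)
  have "twist * m * (2 * \<epsilon> + m * (X - t)) * (X - t) = twist * (m * (X - t)) * (2 * \<epsilon> + m * (X - t))"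
    by Groebner_Basis.algebra
  also have "\<dots> = twist * Y^2 - twist * \<epsilon>^2" unfolding Y by Groebner_Basis.algebra
  also have "\<dots> = (X^2 + X * t + t^2 + a2 * (X + t) + a4) * (X - t)"
    unfolding curve sign_square unfolding twist_def by Groebner_Basis.algebra
  finally show ?thesis using assms(2) P by (simp add: m_def)
qed

lemma on_curve_add_base:
  assumes "on_curve P" "fst P \<noteq> t"
  shows "on_curve (add_base P)"
proof -
  define X X' m where "X = fst P" and "X' = fst (add_base P)" and "m = chord_slope P"
  have X': "X' = twist * m^2 - a2 - X - t" unfolding X'_def X_def m_def by (rule fst_add_base)
  have "X'^3 + a2 * X'^2 + a4 * X' - twist * (\<epsilon> + m * (X' - t))^2
      = (X'^3 + a2 * X'^2 + a4 * X' - twist * \<epsilon>^2)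
        - (2 * \<epsilon> * twist * m * (X' - t) + twist * m^2 * (X' - t)^2)"
    by Groebner_Basis.algebra
  also have "\<dots> = (X' - t) * (X'^2 + X' * t + t^2 + a2 * (X' + t) + a4
      - 2 * \<epsilon> * twist * m - twist * m^2 * (X' - t))"
    unfolding sign_square twist_def by Groebner_Basis.algebra
  also have "X'^2 + X' * t + t^2 + a2 * (X' + t) + a4 - 2 * \<epsilon> * twist * m - twist * m^2 * (X' - t)
      = (X' - X) * (X' + X + t + a2 - twist * m^2)
        + ((X^2 + X * t + t^2 + a2 * (X + t) + a4) - twist * m * (2 * \<epsilon> + m * (X - t)))"
    by Groebner_Basis.algebra
  also have "\<dots> = 0"
    using chord_slope_mult[OF assms] X' by (simp add: X_def m_def)
  finally show ?thesis
    unfolding on_curve_def snd_add_base X'_def[symmetric] m_def[symmetric] power2_minus by simp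
qed

lemma chord_abscissa_add_base:
  assumes "fst (add_base P) \<noteq> t"
  shows "chord_abscissa (-\<epsilon>) (add_base P) = fst P"
proof -
  have "snd (add_base P) - - \<epsilon> = - (chord_slope P * (fst (add_base P) - t))"
    by (simp add: snd_add_base)
  then have "(snd (add_base P) - - \<epsilon>) / (fst (add_base P) - t) = - chord_slope P"
    using assms by simp
  then have "chord_abscissa (-\<epsilon>) (add_base P)
      = twist * (- chord_slope P)^2 - a2 - fst (add_base P) - t"
    by (simp only: chord_abscissa_def)
  then show ?thesis by (simp add: fst_add_base)
qed

lemma fst_if_fst_add_base_eq_base:
  assumes "on_curve P" "fst P \<noteq> t" "fst (add_base P) = t"
  shows "fst P * (4 * twist) = (t^2 - a4)^2"
proof -
  define X m where "X = fst P" and "m = chord_slope P"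
  have square: "twist * m^2 = a2 + 2 * t + X"
    using assms(3) unfolding fst_add_base X_def m_def by (simp add: algebra_simps)
  have "2 * \<epsilon> * twist * m = X^2 + X * t + t^2 + a2 * (X + t) + a4 - (twist * m^2) * (X - t)"
    using chord_slope_mult[OF assms(1,2)] unfolding X_def m_def by Groebner_Basis.algebra
  also have "\<dots> = 3 * t^2 + 2 * a2 * t + a4" unfolding square by Groebner_Basis.algebra
  finally have linear: "2 * \<epsilon> * twist * m = 3 * t^2 + 2 * a2 * t + a4" .
  have "4 * twist * (twist * m^2) * \<epsilon>^2 = (2 * \<epsilon> * twist * m)^2" by Groebner_Basis.algebra
  then have "4 * twist * (a2 + 2 * t + X) = (3 * t^2 + 2 * a2 * t + a4)^2"
    unfolding square linear sign_square by simp
  then have "X * (4 * twist) = (3 * t^2 + 2 * a2 * t + a4)^2 - 4 * twist * (a2 + 2 * t)"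
    by Groebner_Basis.algebra
  also have "\<dots> = (t^2 - a4)^2" unfolding twist_def by Groebner_Basis.algebra
  finally show ?thesis unfolding X_def .
qed

end

lemma prime_elem_dvd_const_poly:
  fixes q :: "'a::field poly"
  assumes "prime_elem q" "q dvd [:c:]"
  shows "c = 0"
  using assms by (metis is_unit_const_poly_iff dvd_trans prime_elem_not_unit dvd_field_iff)

locale nonsingular_cubic =
  fixes a2 a4 :: "'a::field_gcd"
  assumes a4_nonzero: "a4 \<noteq> 0" and discriminant_nonzero: "a2^2 \<noteq> 4 * a4"
    and two_nonzero: "(2::'a) \<noteq> 0"
begin

abbreviation x :: "'a poly" where "x \<equiv> [:0, 1:]"

definition cubic :: "'a poly" where
  "cubic = x^3 + [:a2:] * x^2 + [:a4:] * x"

lemma cubic_eq_pCons: "cubic = [:0, a4, a2, 1:]"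
  by (simp add: cubic_def power2_eq_square power3_eq_cube)

lemma degree_cubic: "degree cubic = 3"
  by (simp add: cubic_eq_pCons)

lemma cubic_nonzero: "cubic \<noteq> 0"
  by (simp add: cubic_eq_pCons)

lemma four_nonzero: "(4::'a) \<noteq> 0"
  using two_nonzero by (metis mult_2 mult_eq_0_iff numeral_Bit0 one_add_one)

lemma no_prime_dvd_cubic_and_duplication:
  assumes "prime_elem q" "q dvd cubic"
  shows "\<not> q dvd x^2 - [:a4:]"
proof
  assume dvd: "q dvd x^2 - [:a4:]"
  have "\<not> q dvd x"
  proof
    assume "q dvd x"
    then have "q dvd x * x - (x^2 - [:a4:])" using dvd by (rule dvd_diff[OF dvd_mult])
    then have "q dvd [:a4:]" by (simp add: power2_eq_square)
    then show False using prime_elem_dvd_const_poly[OF assms(1)] a4_nonzero by blast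
  qed
  moreover have "cubic = x * (x^2 + [:a2:] * x + [:a4:])"
    unfolding cubic_def by Groebner_Basis.algebra
  ultimately have quadratic: "q dvd x^2 + [:a2:] * x + [:a4:]"
    using assms prime_elem_dvd_mult_iff by metis
  have "q dvd (x^2 + [:a2:] * x + [:a4:]) + (x^2 - [:a4:])" using quadratic dvd by (rule dvd_add)
  also have "\<dots> = x * (2 * x + [:a2:])" by Groebner_Basis.algebra
  finally have linear: "q dvd 2 * x + [:a2:]"
    using \<open>\<not> q dvd x\<close> assms(1) prime_elem_dvd_mult_iff by metis
  have "q dvd 2 * ((x^2 + [:a2:] * x + [:a4:]) - (x^2 - [:a4:])) - [:a2:] * (2 * x + [:a2:])"
    by (rule dvd_diff[OF dvd_mult[OF dvd_diff[OF quadratic dvd]] dvd_mult[OF linear]])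
  also have "\<dots> = 4 * [:a4:] - [:a2:]^2" by Groebner_Basis.algebra
  also have "\<dots> = [:4 * a4 - a2^2:]" by (simp add: power2_eq_square numeral_poly)
  finally show False using prime_elem_dvd_const_poly[OF assms(1)] discriminant_nonzero by fastforce
qed

text \<open>
  For \<open>X = A / B\<close> the abscissae of \<open>(X, Y) \<plusminus> (x, \<epsilon>)\<close> are the roots of
  \<open>chord_W z\<^sup>2 - chord_V z + chord_U\<close>.
\<close>

definition chord_U :: "'a poly \<Rightarrow> 'a poly \<Rightarrow> 'a poly" where
  "chord_U A B = (A * x - [:a4:] * B)^2"

definition chord_V :: "'a poly \<Rightarrow> 'a poly \<Rightarrow> 'a poly" where
  "chord_V A B = 2 * ((A * x + [:a4:] * B) * (A + x * B) + 2 * [:a2:] * A * B * x)"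

definition chord_W :: "'a poly \<Rightarrow> 'a poly \<Rightarrow> 'a poly" where
  "chord_W A B = (A - x * B)^2"

definition chord_degree :: "'a poly \<Rightarrow> 'a poly \<Rightarrow> nat" where
  "chord_degree A B
    = max (degree (chord_U A B)) (max (degree (chord_V A B)) (degree (chord_W A B)))"

lemma gcd_chord:
  assumes "coprime A B" "chord_W A B \<noteq> 0"
  shows "gcd (chord_U A B) (gcd (chord_V A B) (chord_W A B)) = 1"
proof (rule gcd_eq_1_if_no_prime_dvd[OF assms(2)])
  fix q assume q: "prime_elem q" "q dvd chord_U A B" "q dvd chord_V A B"
  show "\<not> q dvd chord_W A B"
  proof
    assume "q dvd chord_W A B"
    then have diff: "q dvd A - x * B" using q(1) prime_elem_dvd_power unfolding chord_W_def by blast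
    have not_B: "\<not> q dvd B"
    proof
      assume "q dvd B"
      then have "q dvd (A - x * B) + x * B" by (rule dvd_add[OF diff dvd_mult])
      then have "q dvd A" by simp
      then show False
        using \<open>q dvd B\<close> assms(1) q(1) by (meson coprime_common_divisor prime_elem_not_unit)
    qed
    have "q dvd A * x - [:a4:] * B" using q(1,2) prime_elem_dvd_power unfolding chord_U_def by blast
    then have "q dvd (A * x - [:a4:] * B) - x * (A - x * B)"
      using dvd_mult[OF diff] by (rule dvd_diff)
    also have "\<dots> = B * (x^2 - [:a4:])" by Groebner_Basis.algebra
    finally have duplication: "q dvd x^2 - [:a4:]" using not_B q(1) prime_elem_dvd_mult_iff by blast
    have "q dvd chord_V A B
        - (A - x * B) * (2 * (x * (A + x * B) + x^2 * B + [:a4:] * B + 2 * [:a2:] * x * B))"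
      by (rule dvd_diff[OF q(3) dvd_mult2[OF diff]])
    also have "\<dots> = 4 * (B^2 * cubic)" unfolding chord_V_def cubic_def by Groebner_Basis.algebra
    also have "\<dots> = [:4:] * (B^2 * cubic)" by (simp add: numeral_poly)
    finally have "q dvd [:4:] \<or> q dvd B^2 * cubic" using q(1) prime_elem_dvd_mult_iff by blast
    then have "q dvd B^2 * cubic" using prime_elem_dvd_const_poly[OF q(1)] four_nonzero by blast
    then have "q dvd cubic" using not_B q(1) prime_elem_dvd_mult_iff prime_elem_dvd_power by blast
    then show False using no_prime_dvd_cubic_and_duplication[OF q(1)] duplication by blast
  qed
qed

lemma chord_degree_eq:
  fixes A B :: "'a poly"
  assumes "A \<noteq> 0 \<or> B \<noteq> 0"
  defines "h \<equiv> max (degree A) (degree B)"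
  shows "chord_degree A B = 2 * h + 2"
proof (rule antisym)
  have "degree A \<le> h" "degree B \<le> h" by (simp_all add: h_def)
  then have deg: "degree (A * x) \<le> h + 1" "degree (x * B) \<le> h + 1" "degree ([:a4:] * B) \<le> h + 1"
    "degree A \<le> h + 1" "degree ([:2 * a2:] * A) \<le> h + 1"
    using degree_mult_le[of A x] degree_mult_le[of x B] degree_mult_le[of "[:a4:]" B]
      degree_mult_le[of "[:2 * a2:]" A] by auto
  have mult: "degree (P * Q) \<le> 2 * h + 2"
    if "degree P \<le> h + 1" "degree Q \<le> h + 1" for P Q :: "'a poly"
    using degree_mult_le[of P Q] that by simp
  have "chord_V A B = [:2:] * ((A * x + [:a4:] * B) * (A + x * B) + ([:2 * a2:] * A) * (x * B))"
    unfolding chord_V_def by (simp add: numeral_poly algebra_simps)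
  also have "degree \<dots> \<le> degree ((A * x + [:a4:] * B) * (A + x * B) + ([:2 * a2:] * A) * (x * B))"
    using degree_mult_le[of "[:2:]"] by simp
  also have "\<dots> \<le> 2 * h + 2" by (intro degree_add_le mult deg)
  finally have "degree (chord_V A B) \<le> 2 * h + 2" .
  moreover have "degree (chord_U A B) \<le> 2 * h + 2" "degree (chord_W A B) \<le> 2 * h + 2"
    unfolding chord_U_def chord_W_def power2_eq_square by (intro mult degree_diff_le deg)+
  ultimately show "chord_degree A B \<le> 2 * h + 2" unfolding chord_degree_def by simp
  have "coeff (A * x - [:a4:] * B) (h + 1) = coeff A h" "coeff (A - x * B) (h + 1) = - coeff B h"
    using \<open>degree A \<le> h\<close> \<open>degree B \<le> h\<close> by (simp_all add: coeff_eq_0)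
  then have "coeff (A * x - [:a4:] * B) (h + 1) \<noteq> 0 \<or> coeff (A - x * B) (h + 1) \<noteq> 0"
    using coeff_max_degree_nonzero[OF assms(1)] by (simp add: h_def)
  then have "h + 1 \<le> degree (A * x - [:a4:] * B) \<or> h + 1 \<le> degree (A - x * B)"
    using le_degree by blast
  moreover have "2 * (h + 1) \<le> degree (P^2)" if "h + 1 \<le> degree P" for P :: "'a poly"
    using that by (subst degree_power_eq) auto
  ultimately have "2 * (h + 1) \<le> degree (chord_U A B) \<or> 2 * (h + 1) \<le> degree (chord_W A B)"
    unfolding chord_U_def chord_W_def by blast
  then show "2 * h + 2 \<le> chord_degree A B" unfolding chord_degree_def by auto
qed

lemma height_add_height_chord:
  assumes "X \<noteq> to_fract x"
    and mult: "X1 * X2 * (X - to_fract x)^2 = (X * to_fract x - to_fract [:a4:])^2"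
    and add: "(X1 + X2) * (X - to_fract x)^2
      = 2 * ((X * to_fract x + to_fract [:a4:]) * (X + to_fract x)
        + 2 * to_fract [:a2:] * X * to_fract x)"
  shows "height X1 + height X2 = 2 * height X + 2"
proof -
  obtain A B where reduced: "reduced X A B" using reduced_quot_of_fract by blast
  then have "coprime A B" "B \<noteq> 0" and "X = to_fract A / to_fract B" unfolding reduced_def by auto
  then have A: "to_fract A = X * to_fract B" by simp
  have U: "to_fract (chord_U A B) = (X * to_fract x - to_fract [:a4:])^2 * to_fract B^2"
    unfolding chord_U_def to_fract_power to_fract_diff to_fract_mult A by Groebner_Basis.algebra
  have V: "to_fract (chord_V A B) = 2 * ((X * to_fract x + to_fract [:a4:]) * (X + to_fract x)
      + 2 * to_fract [:a2:] * X * to_fract x) * to_fract B^2"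
    unfolding chord_V_def to_fract_add to_fract_mult to_fract_numeral A by Groebner_Basis.algebra
  have W: "to_fract (chord_W A B) = (X - to_fract x)^2 * to_fract B^2"
    unfolding chord_W_def to_fract_power to_fract_diff to_fract_mult A by Groebner_Basis.algebra
  then have "to_fract (chord_W A B) \<noteq> 0" using assms(1) \<open>B \<noteq> 0\<close> by simp
  then have nonzero: "chord_W A B \<noteq> 0" by auto
  have "height X1 + height X2 = chord_degree A B"
    unfolding chord_degree_def
  proof (rule height_add_height_roots[OF nonzero gcd_chord[OF \<open>coprime A B\<close> nonzero]])
    show "X1 * X2 * to_fract (chord_W A B) = to_fract (chord_U A B)"
      unfolding U W mult[symmetric] by (simp only: mult.assoc)
    show "(X1 + X2) * to_fract (chord_W A B) = to_fract (chord_V A B)"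
      unfolding V W add[symmetric] by (simp only: mult.assoc)
  qed
  then show ?thesis
    using chord_degree_eq \<open>B \<noteq> 0\<close> height_eq_max_degree[OF reduced] by simp
qed

lemma height_double_base:
  assumes "X * (4 * to_fract cubic) = (to_fract x^2 - to_fract [:a4:])^2"
  shows "height X = 4"
proof -
  have nonzero: "[:4:] * cubic \<noteq> 0" using cubic_nonzero four_nonzero by simp
  have "coprime ((x^2 - [:a4:])^2) ([:4:] * cubic)"
  proof (rule coprime_if_no_prime_dvd[OF nonzero])
    fix q assume q: "prime_elem q" "q dvd (x^2 - [:a4:])^2"
    then have "q dvd x^2 - [:a4:]" using prime_elem_dvd_power by blast
    then have "\<not> q dvd cubic" using no_prime_dvd_cubic_and_duplication[OF q(1)] by blast
    then show "\<not> q dvd [:4:] * cubic"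
      using prime_elem_dvd_const_poly[OF q(1)] four_nonzero prime_elem_dvd_mult_iff[OF q(1)]
      by blast
  qed
  moreover have denominator: "to_fract ([:4:] * cubic) = 4 * to_fract cubic"
    by (metis numeral_poly to_fract_mult to_fract_numeral)
  have "to_fract ([:4:] * cubic) \<noteq> 0" unfolding to_fract_eq_0_iff by (rule nonzero)
  then have "X = to_fract ((x^2 - [:a4:])^2) / to_fract ([:4:] * cubic)"
    by (subst nonzero_eq_divide_eq)
      (simp_all only: denominator assms to_fract_power to_fract_diff not_False_eq_True)
  ultimately have "reduced X ((x^2 - [:a4:])^2) ([:4:] * cubic)"
    using nonzero unfolding reduced_def by blast
  then have "height X = max (degree ((x^2 - [:a4:])^2)) (degree ([:4:] * cubic))"
    by (rule height_eq_max_degree)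
  moreover have "degree ((x^2 - [:a4:])^2) = 4"
    by (subst degree_power_eq) (auto simp: power2_eq_square)
  moreover have "degree ([:4:] * cubic) = 3" using four_nonzero degree_cubic by simp
  ultimately show ?thesis by simp
qed

end

definition quad_char :: "'a::finite_field \<Rightarrow> int" where
  "quad_char z = (if z = 0 then 0 else if z ^ ((CARD('a) - 1) div 2) = 1 then 1 else -1)"

lemma quad_char_cases: "quad_char z = 0 \<or> quad_char z = 1 \<or> quad_char z = -1"
  by (simp add: quad_char_def)

lemma quad_char_eq_0_iff [simp]: "quad_char z = 0 \<longleftrightarrow> z = 0"
  by (simp add: quad_char_def)

lemma quad_char_0 [simp]: "quad_char 0 = 0"
  by simp

lemma quad_char_1 [simp]: "quad_char 1 = 1"
  by (simp add: quad_char_def)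

lemma abs_quad_char: "z \<noteq> 0 \<Longrightarrow> \<bar>quad_char z\<bar> = 1"
  by (simp add: quad_char_def)

lemma two_nonzero_if_odd_card:
  assumes "odd (CARD('a::finite_field))"
  shows "(2::'a) \<noteq> 0"
proof
  assume "(2::'a) = 0"
  then have "of_nat 2 = (0::'a)" by simp
  then have "CHAR('a) dvd 2" by (simp only: of_nat_eq_0_iff_char_dvd)
  then have "CHAR('a) = 2"
    using CHAR_prime[where 'a='a] by (metis primes_dvd_imp_eq two_is_prime_nat)
  then show False using CHAR_dvd_CARD[where 'a='a] assms by simp
qed

lemma card_gt_2_if_odd_card:
  assumes "odd (CARD('a::finite_field))"
  shows "CARD('a) > 2"
proof -
  have "card {0, 1, 2::'a} \<le> CARD('a)" by (rule card_mono) simp_all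
  moreover have "(1::'a) \<noteq> 2" by (metis add_cancel_right_right one_add_one zero_neq_one)
  ultimately show ?thesis using two_nonzero_if_odd_card[OF assms] by simp
qed

lemma quad_char_eq_power:
  fixes z :: "'a::finite_field"
  assumes "odd (CARD('a))"
  shows "of_int (quad_char z) = z ^ ((CARD('a) - 1) div 2)"
proof (cases "z = 0")
  case True
  then show ?thesis using card_gt_2_if_odd_card[OF assms] by simp
next
  case False
  have "CARD('a) = Suc (2 * ((CARD('a) - 1) div 2))" using assms by (auto elim!: oddE)
  then have "z * (z ^ ((CARD('a) - 1) div 2))^2 = z * 1"
    using finite_field_power_card_eq_same[of z]
    by (metis power_Suc power_mult mult.commute mult.right_neutral)
  then have "(z ^ ((CARD('a) - 1) div 2))^2 = 1" using False by simp
  then show ?thesis using False by (auto simp: quad_char_def power2_eq_1_iff)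
qed

lemma quad_char_mult:
  fixes y z :: "'a::finite_field"
  assumes "odd (CARD('a))"
  shows "quad_char (y * z) = quad_char y * quad_char z"
proof -
  have "(of_int (quad_char (y * z)) :: 'a) = of_int (quad_char y * quad_char z)"
    using assms by (simp add: quad_char_eq_power power_mult_distrib)
  moreover have "(1::'a) \<noteq> -1"
    using two_nonzero_if_odd_card[OF assms] by (metis add.right_inverse one_add_one)
  ultimately show ?thesis
    using quad_char_cases[of "y * z"] quad_char_cases[of y] quad_char_cases[of z]
    by (cases "y = 0 \<or> z = 0") (auto simp del: quad_char_eq_0_iff)
qed

definition root_poly :: "'a::field set \<Rightarrow> 'a poly" where
  "root_poly S = (\<Prod>r\<in>S. [:-r, 1:])"

lemma degree_root_poly: "degree (root_poly S) = card S"
  by (simp add: root_poly_def degree_prod_eq_sum_degree)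

lemma root_poly_nonzero [simp]: "root_poly S \<noteq> 0"
  by (cases "finite S") (auto simp: root_poly_def)

lemma poly_root_poly_eq_0: "finite S \<Longrightarrow> r \<in> S \<Longrightarrow> poly (root_poly S) r = 0"
  by (auto simp: root_poly_def poly_prod)

lemma root_poly_union:
  "finite S \<Longrightarrow> finite T \<Longrightarrow> S \<inter> T = {} \<Longrightarrow> root_poly (S \<union> T) = root_poly S * root_poly T"
  unfolding root_poly_def by (rule prod.union_disjoint)

lemma coprime_root_poly:
  fixes P :: "'a::field_gcd poly"
  assumes "\<And>r. r \<in> S \<Longrightarrow> poly P r \<noteq> 0"
  shows "coprime P (root_poly S)"
proof -
  have "coprime P [:-r, 1:]" if "r \<in> S" for r
    using prime_elem_imp_coprime[OF prime_elem_linear_field_poly[of 1 "-r"], of P] assms[OF that]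
    by (simp add: poly_eq_0_iff_dvd coprime_commute)
  then show ?thesis unfolding root_poly_def by (rule prod_coprime_right)
qed

lemma root_poly_dvd:
  fixes P :: "'a::field_gcd poly"
  assumes "finite S" "\<And>r. r \<in> S \<Longrightarrow> poly P r = 0"
  shows "root_poly S dvd P"
  using assms
proof (induction S rule: finite_induct)
  case empty
  then show ?case by (simp add: root_poly_def)
next
  case (insert r S)
  have "coprime [:-r, 1:] (root_poly S)"
    by (rule coprime_root_poly) (use insert.hyps in auto)
  moreover have "[:-r, 1:] dvd P" using insert.prems by (simp add: poly_eq_0_iff_dvd)
  ultimately have "[:-r, 1:] * root_poly S dvd P"
    using insert.IH insert.prems by (intro divides_mult) auto
  then show ?case using insert.hyps by (simp add: root_poly_def)
qed

lemma root_poly_UNIV: "root_poly (UNIV :: 'a::finite_field set) = [:0, 1:] ^ CARD('a) - [:0, 1:]"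
proof (rule poly_eqI_degree_lead_coeff[where n = "CARD('a)" and A = UNIV])
  have "CARD('a) > 1" using card_mono[of UNIV "{0, 1::'a}"] by simp
  moreover have "[:0, 1::'a:] ^ n = monom 1 n" for n by (simp add: monom_altdef)
  ultimately show "degree ([:0, 1::'a:] ^ CARD('a) - [:0, 1:]) \<le> CARD('a)"
    and "coeff (root_poly (UNIV :: 'a set)) CARD('a)
      = coeff ([:0, 1:] ^ CARD('a) - [:0, 1:]) CARD('a)"
    using lead_coeff_prod[of "\<lambda>r. [:-r, 1:]" "UNIV :: 'a set"] degree_root_poly[of "UNIV :: 'a set"]
    by (auto intro!: degree_diff_le simp: degree_monom_eq root_poly_def coeff_pCons
        split: nat.splits)
qed (auto simp: degree_root_poly poly_root_poly_eq_0 finite_field_power_card_eq_same)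

locale frobenius_translates = nonsingular_cubic a2 a4
  for a2 a4 :: "'a::{finite_field,field_gcd}" +
  fixes e :: int and q k :: nat
  assumes q_eq_card: "q = CARD('a)" and q_eq_double: "q = 2 * k + 1"
    and q_eq_char_power: "\<exists>n. q = CHAR('a) ^ n" and e_cases: "e = 1 \<or> e = -1"
begin

abbreviation frob :: "'a poly" where "frob \<equiv> x ^ q"
abbreviation sgn_poly :: "'a poly" where "sgn_poly \<equiv> [:of_int e:]"

lemma odd_card: "odd (CARD('a))"
  using q_eq_double by (simp add: q_eq_card[symmetric])

lemma half_card: "(CARD('a) - 1) div 2 = k"
  using q_eq_double by (simp add: q_eq_card[symmetric])

lemma power_q: "r ^ q = (r :: 'a)"
  unfolding q_eq_card by (rule finite_field_power_card_eq_same)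

lemma sgn_poly_square: "sgn_poly ^ 2 = 1"
  using e_cases by (auto simp: power2_eq_square one_pCons)

lemma poly_cubic: "poly cubic r = r^3 + a2 * r^2 + a4 * r"
  by (simp add: cubic_def)

lemma cubic_mult_power_square: "cubic * (cubic ^ k)^2 = frob^3 + [:a2:] * frob^2 + [:a4:] * frob"
proof -
  have power_add: "(F + G) ^ q = F ^ q + G ^ q" for F G :: "'a poly"
    using q_eq_char_power CHAR_prime[where 'a='a] freshmans_dream'[of q _ F G] by auto
  have power_const: "[:c:] ^ q = [:c:]" for c :: 'a
    by (simp add: poly_const_pow power_q)
  have "cubic * (cubic ^ k)^2 = cubic ^ q"
    by (subst q_eq_double) (simp add: power_mult[symmetric] mult.commute)
  also have "\<dots> = (x^3)^q + ([:a2:] * x^2)^q + ([:a4:] * x)^q"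
    unfolding cubic_def by (simp only: power_add)
  also have "\<dots> = frob^3 + [:a2:] * frob^2 + [:a4:] * frob"
    by (simp only: power_mult_distrib power_const) (simp only: power_mult[symmetric] mult.commute)
  finally show ?thesis .
qed

definition char_class :: "int \<Rightarrow> 'a set" where
  "char_class s = {r. quad_char (poly cubic r) = s}"

lemma char_class_cover: "char_class e \<union> char_class 0 \<union> char_class (-e) = UNIV"
proof -
  have "quad_char (poly cubic r) \<in> {e, 0, -e}" for r
    using e_cases quad_char_cases[of "poly cubic r"] by auto
  then show ?thesis unfolding char_class_def by blast
qed

lemma char_class_disjoint:
  "char_class e \<inter> char_class 0 = {}" "(char_class e \<union> char_class 0) \<inter> char_class (-e) = {}"
  using e_cases unfolding char_class_def by auto

lemma frob_diff_eq_root_polys: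
  "frob - x = root_poly (char_class e) * root_poly (char_class 0) * root_poly (char_class (-e))"
proof -
  have "frob - x = root_poly UNIV" unfolding q_eq_card by (rule root_poly_UNIV[symmetric])
  then show ?thesis
    unfolding char_class_cover[symmetric] by (simp only: root_poly_union finite char_class_disjoint)
qed

lemma frob_neq_x: "frob - x \<noteq> 0"
  unfolding frob_diff_eq_root_polys by simp

lemma card_char_classes:
  "q = card (char_class e) + card (char_class 0) + card (char_class (-e))"
  unfolding q_eq_card char_class_cover[symmetric]
  by (simp add: card_Un_disjoint char_class_disjoint)

definition signed_sum :: int where
  "signed_sum = e * (\<Sum>r\<in>UNIV. quad_char (poly cubic r))"

lemma signed_sum_eq: "signed_sum = int (card (char_class e)) - int (card (char_class (-e)))"
proof -
  have "(\<Sum>r\<in>UNIV. quad_char (poly cubic r)) = (\<Sum>r\<in>char_class e. quad_char (poly cubic r))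
      + (\<Sum>r\<in>char_class 0. quad_char (poly cubic r))
      + (\<Sum>r\<in>char_class (-e). quad_char (poly cubic r))"
    unfolding char_class_cover[symmetric] by (simp add: sum.union_disjoint char_class_disjoint)
  also have "\<dots> = e * int (card (char_class e)) - e * int (card (char_class (-e)))"
    by (simp add: char_class_def)
  finally show ?thesis using e_cases unfolding signed_sum_def by auto
qed

text \<open>\<open>first_num / (x\<^sup>q - x)\<^sup>2\<close> is the abscissa of \<open>(x\<^sup>q, cubic\<^sup>k) + (x, e)\<close>.\<close>

definition first_num :: "'a poly" where
  "first_num = (frob * x + [:a4:]) * (frob + x) + 2 * [:a2:] * frob * x
    - 2 * sgn_poly * cubic ^ (k + 1)"

lemma first_num_eq:
  "first_num = cubic * (cubic ^ k - sgn_poly)^2 - ([:a2:] + frob + x) * (frob - x)^2"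
proof -
  have "cubic * (cubic ^ k - sgn_poly)^2
      = cubic * (cubic ^ k)^2 + cubic * sgn_poly^2 - 2 * sgn_poly * (cubic * cubic ^ k)"
    by Groebner_Basis.algebra
  also have "\<dots> = frob^3 + [:a2:] * frob^2 + [:a4:] * frob + cubic
      - 2 * sgn_poly * (cubic * cubic ^ k)"
    unfolding cubic_mult_power_square sgn_poly_square by simp
  finally have square: "cubic * (cubic ^ k - sgn_poly)^2
      = frob^3 + [:a2:] * frob^2 + [:a4:] * frob + cubic
      - 2 * sgn_poly * (cubic * cubic ^ k)" .
  have "(t * y + b) * (t + y) + 2 * a * t * y - 2 * s * (c * d)
      = t^3 + a * t^2 + b * t + c - 2 * s * (c * d) - (a + t + y) * (t - y)^2"
    if "c = y^3 + a * y^2 + b * y" for a b c d s t y :: "'a poly"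
    using that by Groebner_Basis.algebra
  from this[OF cubic_def] show ?thesis unfolding first_num_def square by simp
qed

lemma degree_first_num: "degree first_num = 2 * q + 1"
proof -
  define R where "R = [:a4:] * frob + frob * x^2 + [:a4:] * x + 2 * [:a2:] * frob * x
    - 2 * sgn_poly * cubic ^ (k + 1)"
  have "(t * y + b) * (t + y) + 2 * a * t * y - c
      = t^2 * y + (b * t + t * y^2 + b * y + 2 * a * t * y - c)"
    for a b c t y :: "'a poly"
    by Groebner_Basis.algebra
  then have first_num: "first_num = frob^2 * x + R" unfolding first_num_def R_def .
  have "k \<ge> 1"
    using card_gt_2_if_odd_card[OF odd_card] q_eq_double by (simp add: q_eq_card[symmetric])
  then have q_ge: "q \<ge> 3" using q_eq_double by simp
  have deg_frob: "degree (frob^n) = q * n" for n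
    by (simp add: degree_power_eq power_mult[symmetric])
  have const: "degree ([:c:] * P) \<le> degree P" for c and P :: "'a poly"
    using degree_mult_le[of "[:c:]" P] by simp
  have "degree (2 * sgn_poly * cubic ^ (k + 1)) \<le> degree (cubic ^ (k + 1))"
    using const[of "2 * of_int e" "cubic ^ (k + 1)"] by (simp add: numeral_poly)
  also have "\<dots> = 3 * (k + 1)" by (subst degree_power_eq[OF cubic_nonzero]) (simp add: degree_cubic)
  also have "\<dots> \<le> 2 * q" using \<open>k \<ge> 1\<close> by (simp add: q_eq_double)
  finally have "degree (2 * sgn_poly * cubic ^ (k + 1)) \<le> 2 * q" .
  moreover have "degree ([:a4:] * frob) \<le> 2 * q" using const[of a4 frob] deg_frob[of 1] by simp
  moreover have "degree (frob * x^2) \<le> 2 * q"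
    using degree_mult_le[of frob "x^2"] deg_frob[of 1] q_ge by (simp add: degree_power_eq)
  moreover have "degree ([:a4:] * x) \<le> 2 * q" using const[of a4 x] q_ge by simp
  moreover have "degree (2 * [:a2:] * frob * x) \<le> 2 * q"
    using degree_mult_le[of "[:2 * a2:] * frob" x] const[of "2 * a2" frob] deg_frob[of 1] q_ge
    by (simp add: numeral_poly)
  ultimately have "degree R \<le> 2 * q" unfolding R_def by (intro degree_diff_le degree_add_le)
  moreover have "degree (frob^2 * x) = 2 * q + 1"
    using deg_frob[of 2] by (subst degree_mult_eq) (auto simp: power_eq_0_iff)
  ultimately show ?thesis unfolding first_num by (subst degree_add_eq_left) auto
qed

lemma poly_pderiv_cubic_nonzero:
  assumes "poly cubic r = 0"
  shows "poly (pderiv cubic) r \<noteq> 0"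
proof
  assume deriv: "poly (pderiv cubic) r = 0"
  have root: "r * (r^2 + a2 * r + a4) = 0"
    using assms unfolding poly_cubic by Groebner_Basis.algebra
  have "pderiv cubic = [:a4, 2 * a2, 3:]"
    unfolding cubic_eq_pCons by (simp add: pderiv_pCons)
  then have deriv: "3 * r^2 + 2 * a2 * r + a4 = 0"
    using deriv by (simp add: power2_eq_square algebra_simps)
  then have "r \<noteq> 0" using a4_nonzero by auto
  then have "r^2 + a2 * r + a4 = 0" using root by simp
  then have "a4 * (a2^2 - 4 * a4) = 0" using deriv by Groebner_Basis.algebra
  then show False using a4_nonzero discriminant_nonzero by simp
qed

lemma poly_cubic_power_diff:
  "poly (cubic ^ k - sgn_poly) r = of_int (quad_char (poly cubic r) - e)"
  using half_card by (simp add: quad_char_eq_power[OF odd_card])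

lemma poly_frob_diff: "poly (frob - x) r = 0"
  by (simp add: power_q)

lemma root_polys_dvd_first_num:
  "root_poly (char_class e)^2 * root_poly (char_class 0) dvd first_num" (is "?G dvd _")
proof -
  have "root_poly (char_class e) dvd cubic ^ k - sgn_poly"
    by (rule root_poly_dvd) (auto simp: poly_cubic_power_diff char_class_def simp del: poly_diff)
  moreover have "root_poly (char_class 0) dvd cubic"
    by (rule root_poly_dvd) (auto simp: char_class_def)
  ultimately have "?G dvd (cubic ^ k - sgn_poly)^2 * cubic"
    by (intro mult_dvd_mono dvd_power_same)
  moreover have "(frob - x)^2 = ?G * (root_poly (char_class (-e))^2 * root_poly (char_class 0))"
    unfolding frob_diff_eq_root_polys by Groebner_Basis.algebra
  then have "?G dvd (frob - x)^2" by (metis dvd_triv_left)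
  ultimately show ?thesis
    unfolding first_num_eq by (metis dvd_diff dvd_mult mult.commute)
qed

lemma poly_first_num_nonzero:
  assumes "r \<in> char_class (-e)"
  shows "poly first_num r \<noteq> 0"
proof -
  have "quad_char (poly cubic r) = - e" using assms by (simp add: char_class_def)
  then have "poly cubic r \<noteq> 0" "poly (cubic ^ k - sgn_poly) r \<noteq> 0"
    using e_cases two_nonzero by (auto simp: poly_cubic_power_diff simp del: poly_diff)
  then show ?thesis
    using poly_frob_diff[of r] by (simp add: first_num_eq)
qed

lemma poly_pderiv_first_num_nonzero:
  assumes "r \<in> char_class 0"
  shows "poly (pderiv first_num) r \<noteq> 0"
proof -
  have cubic: "poly cubic r = 0" using assms by (simp add: char_class_def)
  define M where "M = cubic ^ k - sgn_poly"
  have "poly M r \<noteq> 0" using cubic e_cases unfolding M_def poly_cubic_power_diff by auto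
  moreover have "poly (pderiv first_num) r = poly (pderiv cubic) r * poly M r^2"
    unfolding first_num_eq M_def[symmetric] using cubic poly_frob_diff[of r]
    by (simp add: pderiv_diff pderiv_mult pderiv_power)
  ultimately show ?thesis using poly_pderiv_cubic_nonzero[OF cubic] by simp
qed

lemma reduced_first:
  obtains N where
    "reduced (to_fract first_num / to_fract ((frob - x)^2)) N
      (root_poly (char_class (-e))^2 * root_poly (char_class 0))"
    and "first_num = root_poly (char_class e)^2 * root_poly (char_class 0) * N"
proof -
  define G where "G = root_poly (char_class e)^2 * root_poly (char_class 0)"
  define G' where "G' = root_poly (char_class (-e))^2 * root_poly (char_class 0)"
  have GG: "(frob - x)^2 = G * G'"
    unfolding frob_diff_eq_root_polys G_def G'_def by Groebner_Basis.algebra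
  have nonzero: "G \<noteq> 0" "G' \<noteq> 0" unfolding G_def G'_def by simp_all
  obtain N where N: "first_num = G * N"
    using root_polys_dvd_first_num unfolding G_def by (elim dvdE)
  have "poly N r \<noteq> 0" if "r \<in> char_class (-e)" for r
    using poly_first_num_nonzero[OF that] unfolding N by auto
  moreover have "poly N r \<noteq> 0" if "r \<in> char_class 0" for r
  proof -
    have "poly (pderiv first_num) r = poly (pderiv G) r * poly N r"
      unfolding N using that by (simp add: pderiv_mult G_def poly_root_poly_eq_0)
    then show ?thesis using poly_pderiv_first_num_nonzero[OF that] by auto
  qed
  ultimately have "coprime N G'"
    unfolding G'_def by (simp add: coprime_root_poly)
  then have "reduced (to_fract first_num / to_fract ((frob - x)^2)) N G'"
    using nonzero unfolding reduced_def GG N by simp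
  then show ?thesis using that N unfolding G_def G'_def by blast
qed

lemma height_first:
  "int (height (to_fract first_num / to_fract ((frob - x)^2))) = int q + 1 - signed_sum"
proof -
  obtain N where N: "reduced (to_fract first_num / to_fract ((frob - x)^2)) N
      (root_poly (char_class (-e))^2 * root_poly (char_class 0))"
    "first_num = root_poly (char_class e)^2 * root_poly (char_class 0) * N"
    by (rule reduced_first)
  have "N \<noteq> 0" using degree_first_num N(2) by auto
  have deg: "degree (root_poly S^2 * root_poly T) = 2 * card S + card T" for S T :: "'a set"
    by (simp add: degree_mult_eq degree_power_eq degree_root_poly)
  have "2 * q + 1 = 2 * card (char_class e) + card (char_class 0) + degree N"
    using degree_first_num \<open>N \<noteq> 0\<close> unfolding N(2)
    by (subst (asm) degree_mult_eq) (simp_all add: deg)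
  then show ?thesis
    unfolding height_eq_max_degree[OF N(1)] deg signed_sum_eq using card_char_classes by auto
qed

sublocale twisted_cubic "to_fract [:a2:]" "to_fract [:a4:]" "to_fract x" "to_fract sgn_poly"
  by unfold_locales (simp only: to_fract_power[symmetric] sgn_poly_square to_fract_1)

lemma twist_eq: "twist = to_fract cubic"
  unfolding twist_def cubic_def by (simp only: to_fract_add to_fract_mult to_fract_power)

definition translate :: "nat \<Rightarrow> 'a poly fract \<times> 'a poly fract" where
  "translate n = (add_base ^^ n) (to_fract frob, to_fract (cubic ^ k))"

lemma translate_Suc: "translate (Suc n) = add_base (translate n)"
  by (simp add: translate_def)

lemma on_curve_translate:
  assumes "\<And>m. m < n \<Longrightarrow> fst (translate m) \<noteq> to_fract x"
  shows "on_curve (translate n)"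
  using assms
proof (induction n)
  case 0
  have "to_fract (cubic * (cubic ^ k)^2) = to_fract (frob^3 + [:a2:] * frob^2 + [:a4:] * frob)"
    unfolding cubic_mult_power_square ..
  then show ?case
    by (simp only: translate_def on_curve_def twist_eq funpow_0 fst_conv snd_conv
      to_fract_add to_fract_mult to_fract_power)
next
  case (Suc n)
  then show ?case unfolding translate_Suc by (intro on_curve_add_base) auto
qed

lemma height_to_fract: "height (to_fract P) = degree P"
  by (simp add: height_def)

lemma height_translate_0: "height (fst (translate 0)) = q"
  by (simp add: translate_def height_to_fract degree_power_eq del: to_fract_power)

lemma height_translate_1: "int (height (fst (translate 1))) = int q + 1 - signed_sum"
proof -
  have neq: "to_fract frob \<noteq> to_fract x" using frob_neq_x unfolding to_fract_eq_iff by simp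
  have "fst (translate 1) * (to_fract frob - to_fract x)^2 = to_fract first_num"
    using chord_abscissa_mult_square[OF on_curve_translate[of 0, unfolded translate_def funpow_0]
      sign_square neq]
    by (simp only: translate_def funpow_0 One_nat_def funpow.simps o_apply add_base_def fst_conv
      twist_eq first_num_def power_add power_one_right mult_ac
      to_fract_add to_fract_diff to_fract_mult to_fract_numeral) simp
  then have "fst (translate 1) = to_fract first_num / to_fract ((frob - x)^2)"
    using neq unfolding to_fract_power to_fract_diff by (simp add: eq_divide_eq)
  then show ?thesis using height_first by simp
qed

lemma height_translate_Suc_Suc:
  assumes "\<And>m. m \<le> Suc n \<Longrightarrow> fst (translate m) \<noteq> to_fract x"
  shows "height (fst (translate (Suc (Suc n)))) + height (fst (translate n))
    = 2 * height (fst (translate (Suc n))) + 2"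
proof -
  obtain X Y where P: "translate (Suc n) = (X, Y)" by (cases "translate (Suc n)")
  have neq: "X \<noteq> to_fract x" using assms[of "Suc n"] P by simp
  have curve: "on_curve (X, Y)"
    unfolding P[symmetric] by (rule on_curve_translate) (use assms in auto)
  have succ: "fst (translate (Suc (Suc n))) = chord_abscissa (to_fract sgn_poly) (X, Y)"
    unfolding translate_Suc[of "Suc n"] P by (simp add: add_base_def)
  have pred: "fst (translate n) = chord_abscissa (- to_fract sgn_poly) (X, Y)"
    using chord_abscissa_add_base[of "translate n"] neq P unfolding translate_Suc[symmetric] by simp
  show ?thesis
    using height_add_height_chord[OF neq chord_abscissa_mult[OF curve neq]
      chord_abscissa_add[OF curve neq]]
    unfolding succ pred P by simp
qed

lemma height_translate:
  assumes "\<And>m. m < n \<Longrightarrow> fst (translate m) \<noteq> to_fract x"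
  shows "int (height (fst (translate n))) = int n^2 - signed_sum * int n + int q"
  using assms
proof (induction n rule: less_induct)
  case (less n)
  consider "n = 0" | "n = 1" | m where "n = Suc (Suc m)" by (metis One_nat_def not0_implies_Suc)
  then show ?case
  proof cases
    case 1
    then show ?thesis using height_translate_0 by simp
  next
    case 2
    then show ?thesis using height_translate_1 by simp
  next
    case 3
    have "height (fst (translate n)) + height (fst (translate m))
        = 2 * height (fst (translate (Suc m))) + 2"
      unfolding 3 by (rule height_translate_Suc_Suc) (use less.prems 3 in auto)
    then have "int (height (fst (translate n)))
        = 2 * int (height (fst (translate (Suc m)))) + 2 - int (height (fst (translate m)))"
      by linarith
    moreover have "int (height (fst (translate m))) = int m^2 - signed_sum * int m + int q"
      "int (height (fst (translate (Suc m)))) = int (Suc m)^2 - signed_sum * int (Suc m) + int q"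
      by (rule less.IH; use less.prems 3 in force)+
    ultimately have "int (height (fst (translate n)))
        = 2 * (int (Suc m)^2 - signed_sum * int (Suc m) + int q) + 2
          - (int m^2 - signed_sum * int m + int q)"
      by simp
    also have "\<dots> = int n^2 - signed_sum * int n + int q"
      unfolding 3 by (simp add: algebra_simps power2_eq_square)
    finally show ?thesis .
  qed
qed

text \<open>
  A translate can only reach the abscissa \<open>x\<close> at the inverse of the base point, coming from its
  double; the heights \<open>4\<close> and \<open>1\<close> there make the quadratic a perfect square.
\<close>

lemma signed_sum_square_if_translate_meets_base:
  assumes "fst (translate m) = to_fract x" "\<And>i. i < m \<Longrightarrow> fst (translate i) \<noteq> to_fract x"
  shows "signed_sum^2 = 4 * int q"
proof -
  have "m \<noteq> 0"
  proof
    assume "m = 0"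
    then have "to_fract frob = to_fract x"
      using assms(1) by (simp only: translate_def funpow_0 fst_conv)
    then show False using frob_neq_x unfolding to_fract_eq_iff by simp
  qed
  then obtain l where m: "m = Suc l" using not0_implies_Suc by blast
  have "on_curve (translate l)" "fst (translate l) \<noteq> to_fract x"
    using assms m by (auto intro: on_curve_translate)
  then have "fst (translate l) * (4 * to_fract cubic) = (to_fract x^2 - to_fract [:a4:])^2"
    using fst_if_fst_add_base_eq_base assms(1) unfolding m translate_Suc twist_eq by blast
  then have "height (fst (translate l)) = 4" by (rule height_double_base)
  then have height_l: "4 = int l^2 - signed_sum * int l + int q"
    using height_translate[of l] assms(2) m by simp
  have "height (fst (translate m)) = 1" unfolding assms(1) by (simp add: height_to_fract)
  then have "1 = int m^2 - signed_sum * int m + int q" using height_translate[of m] assms(2) by simp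
  then have sum: "signed_sum = 2 * int l + 4"
    using height_l unfolding m by (simp add: algebra_simps power2_eq_square)
  have "int q = (int l + 2)^2"
    using height_l unfolding sum by (simp add: algebra_simps power2_eq_square)
  then show ?thesis unfolding sum by (simp add: algebra_simps power2_eq_square)
qed

lemma signed_sum_square_if_quadratic_nonneg:
  assumes "\<And>n :: nat. int n^2 - signed_sum * int n + int q \<ge> 0" and "signed_sum \<ge> 0"
  shows "signed_sum^2 \<le> 4 * int q"
proof -
  define n where "n = nat (signed_sum div 2)"
  have n: "int n = signed_sum div 2" using assms(2) by (simp add: n_def)
  show ?thesis
  proof (cases "even signed_sum")
    case True
    then have "signed_sum = 2 * int n" using n by simp
    then show ?thesis using assms(1)[of n] by (simp add: power2_eq_square)
  next
    case False
    then have sum: "signed_sum = 2 * int n + 1"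
      using n by (metis add.commute odd_two_times_div_two_succ)
    have "int n * (int n + 1) \<le> int q"
      using assms(1)[of n] unfolding sum by (simp add: power2_eq_square algebra_simps)
    moreover have "int n * (int n + 1) \<noteq> int q"
    proof
      assume "int n * (int n + 1) = int q"
      then have "even (int q)" by (metis even_mult_iff even_plus_one_iff)
      then show False using q_eq_double by simp
    qed
    ultimately show ?thesis unfolding sum by (simp add: power2_eq_square algebra_simps)
  qed
qed

lemma signed_sum_bound:
  assumes "signed_sum \<ge> 0"
  shows "signed_sum^2 \<le> 4 * int q"
proof (cases "\<exists>m. fst (translate m) = to_fract x")
  case True
  then obtain m where "fst (translate m) = to_fract x" "\<And>i. i < m \<Longrightarrow> fst (translate i) \<noteq> to_fract x"
    using exists_least_iff[of "\<lambda>m. fst (translate m) = to_fract x"] by blast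
  then show ?thesis using signed_sum_square_if_translate_meets_base by simp
next
  case False
  then have "int n^2 - signed_sum * int n + int q \<ge> 0" for n
    using height_translate[of n] by (metis of_nat_0_le_iff)
  then show ?thesis using assms by (rule signed_sum_square_if_quadratic_nonneg)
qed

end

theorem hasse_bound:
  fixes a2 a4 :: "'a::{finite_field,field_gcd}"
  assumes "odd (CARD('a))" "CARD('a) = CHAR('a) ^ n" "a4 \<noteq> 0" "a2^2 \<noteq> 4 * a4"
  shows "(\<Sum>r\<in>UNIV. quad_char (r^3 + a2 * r^2 + a4 * r))^2 \<le> 4 * int (CARD('a))"
proof -
  let ?S = "\<Sum>r\<in>UNIV. quad_char (r^3 + a2 * r^2 + a4 * r)"
  define e :: int where "e = (if ?S \<ge> 0 then 1 else -1)"
  interpret frobenius_translates a2 a4 e "CARD('a)" "(CARD('a) - 1) div 2"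
    by unfold_locales (use assms two_nonzero_if_odd_card[OF assms(1)] in \<open>auto simp: e_def\<close>)
  have sum: "signed_sum = e * ?S" unfolding signed_sum_def poly_cubic ..
  then have "signed_sum \<ge> 0" by (auto simp: e_def)
  then have "signed_sum^2 \<le> 4 * int (CARD('a))" by (rule signed_sum_bound)
  moreover have "signed_sum^2 = ?S^2" unfolding sum using e_cases by auto
  ultimately show ?thesis by simp
qed

section \<open>Sign patterns of the quadratic character\<close>

lemma quad_char_prod:
  assumes "odd (CARD('a::finite_field))"
  shows "quad_char (\<Prod>r\<in>J. f r :: 'a) = (\<Prod>r\<in>J. quad_char (f r))"
  by (induction J rule: infinite_finite_induct) (simp_all add: quad_char_mult[OF assms])

lemma quad_char_square:
  assumes "odd (CARD('a::finite_field))" "(z::'a) \<noteq> 0"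
  shows "quad_char z ^ 2 = 1"
  using abs_quad_char[OF assms(2)] by (metis one_power2 power2_abs)

lemma quad_char_inverse:
  assumes "odd (CARD('a::finite_field))"
  shows "quad_char (inverse z :: 'a) = quad_char z"
proof (cases "z = 0")
  case False
  have "quad_char (inverse z) * quad_char z ^ 2 = quad_char (inverse z * z) * quad_char z"
    by (simp only: quad_char_mult[OF assms] power2_eq_square mult.assoc)
  then show ?thesis using False by (simp add: quad_char_square[OF assms])
qed simp

lemma card_quad_char_eq_1_le:
  assumes "odd (CARD('a::finite_field))"
  shows "card {z::'a. quad_char z = 1} \<le> (CARD('a) - 1) div 2"
proof -
  let ?k = "(CARD('a) - 1) div 2"
  define P :: "'a poly" where "P = monom 1 ?k - 1"
  have "coeff P ?k = 1" using card_gt_2_if_odd_card[OF assms] by (simp add: P_def)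
  then have "P \<noteq> 0" by auto
  have "{z. quad_char z = 1} \<subseteq> {z. poly P z = 0}"
    by (auto simp: P_def poly_monom quad_char_def split: if_splits)
  then have "card {z::'a. quad_char z = 1} \<le> card {z. poly P z = 0}" by (intro card_mono) auto
  also have "\<dots> \<le> degree P" using \<open>P \<noteq> 0\<close> by (rule card_poly_roots_bound)
  also have "\<dots> \<le> ?k" unfolding P_def by (intro degree_diff_le) (auto simp: degree_monom_le)
  finally show ?thesis .
qed

lemma exists_quad_char_eq_minus_1:
  assumes "odd (CARD('a::finite_field))"
  shows "\<exists>n::'a. quad_char n = -1"
proof (rule ccontr)
  assume "\<nexists>n::'a. quad_char n = -1"
  then have "UNIV - {0::'a} \<subseteq> {z. quad_char z = 1}"
    using quad_char_cases quad_char_eq_0_iff by blast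
  then have "card (UNIV - {0::'a}) \<le> card {z::'a. quad_char z = 1}" by (intro card_mono) auto
  also have "\<dots> \<le> (CARD('a) - 1) div 2" by (rule card_quad_char_eq_1_le[OF assms])
  finally show False using card_gt_2_if_odd_card[OF assms] by (simp add: card_Diff_singleton)
qed

definition char_sum :: "'a::finite_field set \<Rightarrow> int" where
  "char_sum J = (\<Sum>z\<in>UNIV. \<Prod>r\<in>J. quad_char (z - r))"

lemma char_sum_translate: "char_sum ((\<lambda>r. r - t) ` J) = char_sum J"
proof -
  have "char_sum ((\<lambda>r. r - t) ` J) = (\<Sum>z\<in>UNIV. \<Prod>r\<in>J. quad_char (z - (r - t)))"
    unfolding char_sum_def by (simp add: prod.reindex)
  also have "\<dots> = char_sum J"
    unfolding char_sum_def
    by (rule sum.reindex_bij_witness[of _ "\<lambda>z. z - t" "\<lambda>z. z + t"]) (auto simp: algebra_simps)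
  finally show ?thesis .
qed

lemma char_sum_singleton:
  fixes r :: "'a::finite_field"
  assumes "odd (CARD('a))"
  shows "char_sum {r} = 0"
proof -
  obtain n :: 'a where n: "quad_char n = -1" using exists_quad_char_eq_minus_1[OF assms] by blast
  then have "n \<noteq> 0" by auto
  have "(\<Sum>z\<in>UNIV. quad_char (n * z)) = (\<Sum>z\<in>(UNIV::'a set). quad_char z)"
    by (rule sum.reindex_bij_witness[of _ "\<lambda>z. z / n" "\<lambda>z. n * z"]) (use \<open>n \<noteq> 0\<close> in auto)
  then have "(\<Sum>z\<in>(UNIV::'a set). quad_char z) = 0"
    by (simp add: quad_char_mult[OF assms] n sum_negf)
  then show ?thesis using char_sum_translate[of r "{r}"] by (simp add: char_sum_def)
qed

lemma char_sum_insert_0: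
  fixes J :: "'a::finite_field set"
  assumes odd: "odd (CARD('a))" and J: "0 \<notin> J" "odd (card J)"
  shows "char_sum (insert 0 J) = quad_char (\<Prod>r\<in>J. - r) * char_sum (inverse ` J) - 1"
proof -
  let ?c = "quad_char (\<Prod>r\<in>J. - r)"
  have "finite J" by simp
  have inverted: "(\<Prod>r\<in>insert 0 J. quad_char (inverse w - r))
      = ?c * (\<Prod>r\<in>J. quad_char (w - inverse r))"
    if "w \<noteq> 0" for w
  proof -
    have "inverse w - r = - r * (w - inverse r) * inverse w" if "r \<in> J" for r
      using that J(1) \<open>w \<noteq> 0\<close> by (auto simp: field_simps)
    then have "(\<Prod>r\<in>J. quad_char (inverse w - r))
        = (\<Prod>r\<in>J. quad_char (- r) * quad_char (w - inverse r) * quad_char w)"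
      by (intro prod.cong) (simp_all only: quad_char_mult[OF odd] quad_char_inverse[OF odd])
    then have "(\<Prod>r\<in>insert 0 J. quad_char (inverse w - r))
        = ?c * (\<Prod>r\<in>J. quad_char (w - inverse r)) * quad_char w ^ Suc (card J)"
      using J(1) by (simp add: prod.distrib quad_char_prod[OF odd] quad_char_inverse[OF odd])
    moreover obtain m where "Suc (card J) = 2 * m" using J(2) by (metis evenE even_Suc)
    ultimately show ?thesis by (simp add: power_mult quad_char_square[OF odd that])
  qed
  have "char_sum (insert 0 J) = (\<Sum>z\<in>UNIV - {0}. \<Prod>r\<in>insert 0 J. quad_char (z - r))"
    unfolding char_sum_def using \<open>finite J\<close> by (intro sum.mono_neutral_right) auto
  also have "\<dots> = (\<Sum>w\<in>UNIV - {0}. ?c * (\<Prod>r\<in>J. quad_char (w - inverse r)))"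
    by (rule sum.reindex_bij_witness[of _ inverse inverse]) (auto simp: inverted[symmetric])
  also have "\<dots> = ?c * (char_sum (inverse ` J) - (\<Prod>r\<in>J. quad_char (0 - inverse r)))"
    unfolding sum_distrib_left[symmetric] char_sum_def
    by (simp add: sum_diff1 prod.reindex inj_on_def)
  finally have sum: "char_sum (insert 0 J)
      = ?c * (char_sum (inverse ` J) - (\<Prod>r\<in>J. quad_char (0 - inverse r)))" .
  have "?c * (\<Prod>r\<in>J. quad_char (0 - inverse r)) = quad_char (\<Prod>r\<in>J. - r * (0 - inverse r))"
    unfolding quad_char_prod[OF odd] prod.distrib[symmetric] quad_char_mult[OF odd] ..
  also have "(\<Prod>r\<in>J. - r * (0 - inverse r)) = 1"
  proof (intro prod.neutral ballI)
    fix r assume "r \<in> J"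
    then show "- r * (0 - inverse r) = 1" using J(1) by (cases "r = 0") auto
  qed
  finally show ?thesis unfolding sum by (simp add: right_diff_distrib)
qed

lemma char_sum_pair:
  fixes J :: "'a::finite_field set"
  assumes "odd (CARD('a))" "card J = 2"
  shows "char_sum J = -1"
proof -
  obtain r t where J: "J = {r, t}" "r \<noteq> t" using assms(2) by (metis card_2_iff)
  have "char_sum J = char_sum (insert 0 {t - r})"
    using char_sum_translate[of r J] J by simp
  also have "\<dots> = -1"
    using J by (subst char_sum_insert_0[OF assms(1)]) (auto simp: char_sum_singleton[OF assms(1)])
  finally show ?thesis .
qed

lemma abs_char_sum_triple:
  fixes J :: "'a::{finite_field,field_gcd} set"
  assumes "odd (CARD('a))" "CARD('a) = CHAR('a) ^ n" "card J = 3"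
  shows "\<bar>real_of_int (char_sum J)\<bar> \<le> 2 * sqrt (CARD('a))"
proof -
  obtain r t u where J: "J = {r, t, u}" "r \<noteq> t" "r \<noteq> u" "t \<noteq> u" using assms(3) by (metis card_3_iff)
  define v w where "v = t - r" and "w = u - r"
  have "(\<Prod>s\<in>{0, v, w}. quad_char (z - s)) = quad_char (z^3 + (-(v + w)) * z^2 + (v * w) * z)" for z
  proof -
    have "(\<Prod>s\<in>{0, v, w}. quad_char (z - s)) = quad_char (z * ((z - v) * (z - w)))"
      using J by (simp add: v_def w_def quad_char_mult[OF assms(1)])
    also have "z * ((z - v) * (z - w)) = z^3 + (-(v + w)) * z^2 + (v * w) * z"
      by Groebner_Basis.algebra
    finally show ?thesis .
  qed
  then have "char_sum {0, v, w} = (\<Sum>z\<in>UNIV. quad_char (z^3 + (-(v + w)) * z^2 + (v * w) * z))"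
    unfolding char_sum_def by simp
  moreover have "v * w \<noteq> 0" using J by (simp add: v_def w_def)
  moreover have "(-(v + w))^2 - 4 * (v * w) = (t - u)^2"
    unfolding v_def w_def by Groebner_Basis.algebra
  then have "(-(v + w))^2 \<noteq> 4 * (v * w)" using J by auto
  moreover have "char_sum J = char_sum {0, v, w}"
    using char_sum_translate[of r J] by (simp add: J v_def w_def)
  ultimately have "char_sum J ^ 2 \<le> 4 * int (CARD('a))"
    using hasse_bound[OF assms(1,2), of "v * w" "-(v + w)"] by simp
  then have "real_of_int (char_sum J ^ 2) \<le> real_of_int (4 * int (CARD('a)))"
    by (simp only: of_int_le_iff)
  then have "\<bar>real_of_int (char_sum J)\<bar>^2 \<le> (2 * sqrt (CARD('a)))^2"
    by (simp add: power_mult_distrib)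
  then show ?thesis by (rule power2_le_imp_le) simp
qed

lemma abs_char_sum_quadruple:
  fixes J :: "'a::{finite_field,field_gcd} set"
  assumes "odd (CARD('a))" "CARD('a) = CHAR('a) ^ n" "card J = 4"
  shows "\<bar>real_of_int (char_sum J)\<bar> \<le> 2 * sqrt (CARD('a)) + 1"
proof -
  obtain r K where J: "J = insert r K" "r \<notin> K" "card K = 3"
    using assms(3) by (metis card_Suc_eq numeral_eq_Suc pred_numeral_simps(2) semiring_norm(26,27))
  define K' where "K' = (\<lambda>s. s - r) ` K"
  have K': "0 \<notin> K'" "card K' = 3" using J by (auto simp: K'_def card_image inj_on_def)
  let ?c = "quad_char (\<Prod>s\<in>K'. - s)"
  have "char_sum J = char_sum (insert 0 K')"
    using char_sum_translate[of r J] by (simp add: J K'_def)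
  also have "\<dots> = ?c * char_sum (inverse ` K') - 1"
    using K' by (intro char_sum_insert_0[OF assms(1)]) auto
  finally have "real_of_int (char_sum J)
      = real_of_int ?c * real_of_int (char_sum (inverse ` K')) - 1"
    by simp
  moreover have "\<bar>?c\<bar> = 1" using K' by (intro abs_quad_char) auto
  then have "\<bar>real_of_int ?c\<bar> = 1" by (metis of_int_abs of_int_1)
  moreover have "\<bar>real_of_int (char_sum (inverse ` K'))\<bar> \<le> 2 * sqrt (CARD('a))"
    using K' by (intro abs_char_sum_triple[OF assms(1,2)]) (simp add: card_image inj_on_def)
  ultimately show ?thesis
    using abs_triangle_ineq4[of "real_of_int ?c * real_of_int (char_sum (inverse ` K'))" 1]
    by (simp add: abs_mult)
qed

lemma sum_Pow_card:
  assumes "finite A"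
  shows "(\<Sum>J\<in>Pow A. f (card J))
    = (\<Sum>k\<le>card A. of_nat (card A choose k) * f k :: 'b::comm_semiring_1)"
proof -
  have "(\<Sum>J\<in>Pow A. f (card J)) = (\<Sum>k\<le>card A. \<Sum>J | J \<in> Pow A \<and> card J = k. f (card J))"
    using assms by (intro sum.group[symmetric]) (auto intro: card_mono)
  also have "\<dots> = (\<Sum>k\<le>card A. of_nat (card A choose k) * f k)"
    using n_subsets[OF assms] by (intro sum.cong) auto
  finally show ?thesis .
qed

definition pattern_weight :: "('a::finite_field \<Rightarrow> int) \<Rightarrow> 'a set \<Rightarrow> 'a \<Rightarrow> int" where
  "pattern_weight \<sigma> D z = (\<Prod>r\<in>D. 1 + \<sigma> r * quad_char (z - r))"

lemma pattern_weight_eq_0: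
  assumes "\<And>r. r \<in> D \<Longrightarrow> \<bar>\<sigma> r\<bar> = 1" and "r \<in> D" "z \<noteq> r" "quad_char (z - r) \<noteq> \<sigma> r"
  shows "pattern_weight \<sigma> D z = 0"
proof -
  have "1 + \<sigma> r * quad_char (z - r) = 0"
    using assms(1)[OF assms(2)] assms(3,4) quad_char_cases[of "z - r"]
    by (auto simp: abs_if split: if_splits)
  then show ?thesis using assms(2) unfolding pattern_weight_def by (intro prod_zero) auto
qed

lemma pattern_weight_le:
  assumes "\<And>r. r \<in> D \<Longrightarrow> \<bar>\<sigma> r\<bar> = 1" and "z \<in> D"
  shows "pattern_weight \<sigma> D z \<le> 2 ^ (card D - 1)"
proof -
  have "pattern_weight \<sigma> D z = (\<Prod>r\<in>D - {z}. 1 + \<sigma> r * quad_char (z - r))"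
    unfolding pattern_weight_def using assms(2) by (simp add: prod.remove)
  also have "\<dots> \<le> (\<Prod>r\<in>D - {z}. 2)"
  proof (rule prod_mono)
    fix r assume "r \<in> D - {z}"
    then have "\<bar>\<sigma> r\<bar> = 1" using assms(1) by simp
    then show "0 \<le> 1 + \<sigma> r * quad_char (z - r) \<and> 1 + \<sigma> r * quad_char (z - r) \<le> 2"
      using quad_char_cases[of "z - r"] by (auto simp: abs_if split: if_splits)
  qed
  also have "\<dots> = 2 ^ (card D - 1)" using assms(2) by (simp add: card_Diff_singleton)
  finally show ?thesis .
qed

definition char_sum_lower :: "nat \<Rightarrow> nat \<Rightarrow> real" where
  "char_sum_lower q m = [real q, 0, -1, - 2 * sqrt q, - 2 * sqrt q - 1] ! m"

lemma char_sum_lower_le: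
  fixes J :: "'a::{finite_field,field_gcd} set"
  assumes q: "odd (CARD('a))" "CARD('a) = CHAR('a) ^ n"
    and "card J \<le> 4" and \<epsilon>: "\<bar>\<epsilon>\<bar> = 1" "J = {} \<Longrightarrow> \<epsilon> = 1"
  shows "char_sum_lower (CARD('a)) (card J) \<le> real_of_int (\<epsilon> * char_sum J)"
proof -
  have "\<bar>real_of_int \<epsilon>\<bar> = 1" using \<epsilon>(1) by (metis of_int_1 of_int_abs)
  then have abs_eq: "\<bar>real_of_int (\<epsilon> * char_sum J)\<bar> = \<bar>real_of_int (char_sum J)\<bar>"
    by (simp only: of_int_mult abs_mult mult_1)
  have "card J = 0 \<or> card J = 1 \<or> card J = 2 \<or> card J = 3 \<or> card J = 4"
    using assms(3) by linarith
  then consider "J = {}" | "card J = 1" | "card J = 2" | "card J = 3" | "card J = 4" by auto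
  then show ?thesis
  proof cases
    case 1
    then show ?thesis using \<epsilon>(2) by (simp add: char_sum_lower_def char_sum_def)
  next
    case 2
    then show ?thesis
      by (auto simp: char_sum_lower_def card_1_singleton_iff char_sum_singleton[OF q(1)])
  next
    case 3
    then show ?thesis using abs_eq char_sum_pair[OF q(1) 3] by (simp add: char_sum_lower_def)
  next
    case 4
    then show ?thesis using abs_eq abs_char_sum_triple[OF q 4] by (simp add: char_sum_lower_def)
  next
    case 5
    then show ?thesis using abs_eq abs_char_sum_quadruple[OF q 5] by (simp add: char_sum_lower_def)
  qed
qed

lemma sum_pattern_weight:
  "(\<Sum>z\<in>UNIV. pattern_weight \<sigma> D z) = (\<Sum>J\<in>Pow D. (\<Prod>r\<in>J. \<sigma> r) * char_sum J)"
proof -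
  have "pattern_weight \<sigma> D z = (\<Sum>J\<in>Pow D. (\<Prod>r\<in>J. \<sigma> r) * (\<Prod>r\<in>J. quad_char (z - r)))" for z
    unfolding pattern_weight_def by (simp add: add.commute[of 1] prod_add prod.distrib)
  then show ?thesis
    unfolding char_sum_def sum_distrib_left by (simp only: sum.swap[of _ _ "Pow D"])
qed

lemma sum_pattern_weight_ge:
  fixes D :: "'a::{finite_field,field_gcd} set"
  assumes q: "odd (CARD('a))" "CARD('a) = CHAR('a) ^ n"
    and D: "card D = 4" "\<And>r. r \<in> D \<Longrightarrow> \<bar>\<sigma> r\<bar> = 1"
  shows "CARD('a) - 10 * sqrt (CARD('a)) - 7 \<le> real_of_int (\<Sum>z\<in>UNIV. pattern_weight \<sigma> D z)"
proof -
  have "CARD('a) - 10 * sqrt (CARD('a)) - 7 = (\<Sum>J\<in>Pow D. char_sum_lower (CARD('a)) (card J))"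
    by (simp add: sum_Pow_card D(1) char_sum_lower_def numeral_eq_Suc)
  also have "\<dots> \<le> (\<Sum>J\<in>Pow D. real_of_int ((\<Prod>r\<in>J. \<sigma> r) * char_sum J))"
  proof (rule sum_mono)
    fix J assume "J \<in> Pow D"
    then have "\<bar>\<Prod>r\<in>J. \<sigma> r\<bar> = 1" "card J \<le> 4"
      using D card_mono[of D J] by (simp_all add: abs_prod subset_iff)
    then show "char_sum_lower (CARD('a)) (card J) \<le> real_of_int ((\<Prod>r\<in>J. \<sigma> r) * char_sum J)"
      by (intro char_sum_lower_le[OF q]) auto
  qed
  also have "\<dots> = real_of_int (\<Sum>z\<in>UNIV. pattern_weight \<sigma> D z)" by (simp add: sum_pattern_weight)
  finally show ?thesis .
qed

lemma sign_pattern_exists: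
  fixes D :: "'a::{finite_field,field_gcd} set"
  assumes q: "odd (CARD('a))" "CARD('a) = CHAR('a) ^ n"
    and D: "card D = 4" "\<And>r. r \<in> D \<Longrightarrow> \<bar>\<sigma> r\<bar> = 1"
    and B: "B \<subseteq> D" "8 * card B + 10 * sqrt (CARD('a)) + 7 < CARD('a)"
  shows "\<exists>s. s \<notin> B \<and> (\<forall>r\<in>D. s = r \<or> quad_char (s - r) = \<sigma> r)"
proof (rule ccontr)
  assume "\<not> ?thesis"
  then have "pattern_weight \<sigma> D z = 0" if "z \<notin> B" for z
    using that pattern_weight_eq_0[of D \<sigma>] D(2) by metis
  then have "(\<Sum>z\<in>UNIV. pattern_weight \<sigma> D z) = (\<Sum>z\<in>B. pattern_weight \<sigma> D z)"
    by (intro sum.mono_neutral_right) auto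
  also have "\<dots> \<le> of_nat (card B) * 8"
    using pattern_weight_le[of D \<sigma>] D B(1) by (intro sum_bounded_above) auto
  finally have "real_of_int (\<Sum>z\<in>UNIV. pattern_weight \<sigma> D z) \<le> 8 * card B" by linarith
  then show False using sum_pattern_weight_ge[OF q D(1), of \<sigma>] D(2) B(2) by auto
qed

section \<open>Orthomorphisms through three points\<close>

definition orthomorphism :: "('a::ab_group_add \<Rightarrow> 'a) \<Rightarrow> bool" where
  "orthomorphism f \<longleftrightarrow> bij f \<and> bij (\<lambda>u. f u - u)"

lemma bij_if_inj: "inj f \<Longrightarrow> bij f" for f :: "'a::finite \<Rightarrow> 'a"
  by (simp add: bij_def finite_UNIV_inj_surj)

lemma orthomorphism_reflect:
  assumes "orthomorphism f"
  shows "orthomorphism (\<lambda>u. u - f u)"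
proof -
  have "bij (uminus \<circ> (\<lambda>u. f u - u))" "bij (uminus \<circ> f)"
    using assms unfolding orthomorphism_def by (blast intro: bij_comp bij_uminus)+
  then show ?thesis by (simp add: orthomorphism_def comp_def)
qed

lemma orthomorphism_inv_into:
  assumes "orthomorphism f"
  shows "orthomorphism (inv_into UNIV f)"
proof -
  have f: "bij f" "bij (\<lambda>u. f u - u)" using assms by (auto simp: orthomorphism_def)
  have "inv_into UNIV f u - u = - (f (inv_into UNIV f u) - inv_into UNIV f u)" for u
    using f(1) by (simp add: bij_is_surj surj_f_inv_f)
  moreover have "bij (uminus \<circ> ((\<lambda>u. f u - u) \<circ> inv_into UNIV f))"
    using f by (blast intro: bij_comp bij_uminus bij_imp_bij_inv)
  ultimately have "bij (\<lambda>u. inv_into UNIV f u - u)" by (simp add: comp_def)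
  then show ?thesis using f(1) by (simp add: orthomorphism_def bij_imp_bij_inv)
qed

lemma bij_affine: "(l::'a::field) \<noteq> 0 \<Longrightarrow> bij (\<lambda>u. b + l * u)"
  by (rule bij_betw_byWitness[where f' = "\<lambda>u. (u - b) / l"]) auto

lemma orthomorphism_affine:
  fixes l :: "'a::field"
  assumes "orthomorphism f" "l \<noteq> 0"
  shows "orthomorphism (\<lambda>u. b + l * f ((u - a) / l))"
proof -
  have f: "bij f" "bij (\<lambda>u. f u - u)" using assms by (auto simp: orthomorphism_def)
  have inner: "bij (\<lambda>u. (u - a) / l)"
    by (rule bij_betw_byWitness[where f' = "\<lambda>u. a + l * u"]) (use assms(2) in auto)
  have cancel: "l * ((u - a) / l) = u - a" for u using assms(2) by simp
  have shift: "b + l * f ((u - a) / l) - u = (b - a) + l * (f ((u - a) / l) - (u - a) / l)" for u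
    unfolding right_diff_distrib cancel by simp
  have "bij ((\<lambda>u. b + l * u) \<circ> (f \<circ> (\<lambda>u. (u - a) / l)))"
    "bij ((\<lambda>u. (b - a) + l * u) \<circ> ((\<lambda>u. f u - u) \<circ> (\<lambda>u. (u - a) / l)))"
    using inner f bij_affine[OF assms(2)] by (blast intro: bij_comp)+
  then show ?thesis by (simp only: orthomorphism_def comp_def shift)
qed

lemma orthomorphism_linear:
  fixes m :: "'a::field"
  assumes "m \<noteq> 0" "m \<noteq> 1"
  shows "orthomorphism (\<lambda>u. m * u)"
  using bij_affine[of m 0] bij_affine[of "m - 1" 0] assms
  by (simp add: orthomorphism_def left_diff_distrib)

definition quad_map :: "'a::finite_field \<Rightarrow> 'a \<Rightarrow> 'a \<Rightarrow> 'a" where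
  "quad_map s c z = (if quad_char z = 1 then s * z else c * z)"

lemma bij_quad_map:
  assumes "odd (CARD('a::finite_field))" "quad_char s = quad_char c" "(s::'a) \<noteq> 0"
  shows "bij (quad_map s c)"
proof (rule bij_if_inj[OF injI])
  fix z w :: 'a
  assume eq: "quad_map s c z = quad_map s c w"
  have "c \<noteq> 0" using assms(2,3) by (metis quad_char_eq_0_iff)
  have "quad_char (quad_map s c v) = quad_char s * quad_char v" for v
    by (simp add: quad_map_def quad_char_mult[OF assms(1)] assms(2))
  then have "quad_char z = quad_char w"
    using eq assms(3) by (metis mult_cancel_left quad_char_eq_0_iff)
  then show "z = w" using eq \<open>c \<noteq> 0\<close> assms(3) by (auto simp: quad_map_def split: if_splits)
qed

lemma orthomorphism_quad_map:
  assumes "odd (CARD('a::finite_field))" "quad_char s = quad_char c"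
    "quad_char (s - 1) = quad_char (c - 1)"
    and "(s::'a) \<noteq> 0" "s \<noteq> 1"
  shows "orthomorphism (quad_map s c)"
proof -
  have "(\<lambda>z. quad_map s c z - z) = quad_map (s - 1) (c - 1)"
    by (auto simp: quad_map_def algebra_simps)
  then show ?thesis using assms by (simp add: orthomorphism_def bij_quad_map)
qed

definition slopes_occur :: "'a::field \<Rightarrow> 'a \<Rightarrow> 'a \<Rightarrow> bool" where
  "slopes_occur a b c \<longleftrightarrow> (\<exists>f x y z. orthomorphism f \<and> distinct [x, y, z] \<and>
     f z - f y = a * (z - y) \<and> f z - f x = b * (z - x) \<and> f y - f x = c * (y - x))"

lemma slopes_occurI:
  assumes "orthomorphism f" "distinct [x, y, z]"
    "f z - f y = a * (z - y)" "f z - f x = b * (z - x)" "f y - f x = c * (y - x)"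
  shows "slopes_occur a b c"
  unfolding slopes_occur_def using assms by blast

lemma slopes_occurE:
  assumes "slopes_occur a b c"
  obtains f x y z where "orthomorphism f" "distinct [x, y, z]"
    "f z - f y = a * (z - y)" "f z - f x = b * (z - x)" "f y - f x = c * (y - x)"
  using assms unfolding slopes_occur_def by blast

lemma slopes_occur_swap12: "slopes_occur a b c \<Longrightarrow> slopes_occur b a c"
proof (erule slopes_occurE)
  fix f x y z
  assume f: "orthomorphism f" "distinct [x, y, z]"
    "f z - f y = a * (z - y)" "f z - f x = b * (z - x)" "f y - f x = c * (y - x)"
  have "f x - f y = c * (x - y)" using f(5) by Groebner_Basis.algebra
  then show ?thesis using f by (intro slopes_occurI[of f y x z]) auto
qed

lemma slopes_occur_swap23: "slopes_occur a b c \<Longrightarrow> slopes_occur a c b"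
proof (erule slopes_occurE)
  fix f x y z
  assume f: "orthomorphism f" "distinct [x, y, z]"
    "f z - f y = a * (z - y)" "f z - f x = b * (z - x)" "f y - f x = c * (y - x)"
  have "f y - f z = a * (y - z)" using f(3) by Groebner_Basis.algebra
  then show ?thesis using f by (intro slopes_occurI[of f x z y]) auto
qed

lemma slopes_occur_one_minus: "slopes_occur a b c \<Longrightarrow> slopes_occur (1 - a) (1 - b) (1 - c)"
proof (erule slopes_occurE)
  fix f x y z
  assume f: "orthomorphism f" "distinct [x, y, z]"
    "f z - f y = a * (z - y)" "f z - f x = b * (z - x)" "f y - f x = c * (y - x)"
  show ?thesis
    by (rule slopes_occurI[OF orthomorphism_reflect[OF f(1)] f(2)])
      (use f(3-5) in \<open>simp_all add: algebra_simps\<close>)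
qed

lemma slopes_occur_inverse:
  assumes "slopes_occur a b c" "a \<noteq> 0" "b \<noteq> 0" "c \<noteq> 0"
  shows "slopes_occur (1 / a) (1 / b) (1 / c)"
  using assms(1)
proof (rule slopes_occurE)
  fix f x y z
  assume f: "orthomorphism f" "distinct [x, y, z]"
    "f z - f y = a * (z - y)" "f z - f x = b * (z - x)" "f y - f x = c * (y - x)"
  have "inj f" using f(1) by (simp add: orthomorphism_def bij_is_inj)
  then show ?thesis
    using f(2-5) assms(2-4)
    by (intro slopes_occurI[OF orthomorphism_inv_into[OF f(1)], of "f x" "f y" "f z"])
      (simp_all add: inj_eq)
qed

definition companion_slope :: "'a::finite_field \<Rightarrow> 'a \<Rightarrow> 'a \<Rightarrow> 'a \<Rightarrow> bool" where
  "companion_slope a b c s \<longleftrightarrow> s \<noteq> 0 \<and> s \<noteq> 1 \<and>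
     quad_char s = quad_char c \<and> quad_char (s - 1) = quad_char (c - 1) \<and>
     (s = a \<or> quad_char (s - a) = - quad_char (c - a)) \<and>
     (s = b \<or> quad_char (s - b) = - quad_char (c - b))"

text \<open>
  With \<open>u = (s - b) / (c - b)\<close> and \<open>v = (s - a) / (c - a)\<close>, which are not nonzero squares, the
  triangle is \<open>(u, c u)\<close>, \<open>(v, c v)\<close>, \<open>(1, s)\<close>.
\<close>

lemma slopes_occur_if_companion_slope:
  fixes a b c s :: "'a::finite_field"
  assumes odd: "odd (CARD('a))" and distinct: "a \<noteq> b" "a \<noteq> c" "b \<noteq> c"
    and s: "companion_slope a b c s"
  shows "slopes_occur a b c"
proof -
  have "s \<noteq> c" using s distinct by (auto simp: companion_slope_def)
  define u v where "u = (s - b) / (c - b)" and "v = (s - a) / (c - a)"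
  have uv: "u * (c - b) = s - b" "v * (c - a) = s - a" using distinct by (simp_all add: u_def v_def)
  have not_square: "quad_char ((s - r) / (c - r)) \<noteq> 1"
    if "s = r \<or> quad_char (s - r) = - quad_char (c - r)" "c \<noteq> r" for r
    using that quad_char_square[OF odd, of "c - r"]
    by (auto simp: divide_inverse quad_char_mult[OF odd] quad_char_inverse[OF odd] power2_eq_square)
  have f: "quad_map s c u = c * u" "quad_map s c v = c * v" "quad_map s c 1 = s"
    using not_square[of a] not_square[of b] s distinct
    unfolding quad_map_def u_def v_def companion_slope_def by auto
  have "u \<noteq> 1" "v \<noteq> 1" using uv \<open>s \<noteq> c\<close> by auto
  moreover have "u \<noteq> v"
  proof
    assume "u = v"
    have "(b - a) * (s - c) = 0" using uv unfolding \<open>u = v\<close> by Groebner_Basis.algebra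
    then show False using distinct \<open>s \<noteq> c\<close> by simp
  qed
  moreover have "s - c * v = a * (1 - v)" using uv(2) by Groebner_Basis.algebra
  moreover have "s - c * u = b * (1 - u)" using uv(1) by Groebner_Basis.algebra
  moreover have "orthomorphism (quad_map s c)"
    using s by (intro orthomorphism_quad_map[OF odd]) (simp_all add: companion_slope_def)
  ultimately show ?thesis
    by (intro slopes_occurI[of "quad_map s c" u v 1]) (auto simp: f algebra_simps)
qed

definition universal_slope :: "'a::field \<Rightarrow> bool" where
  "universal_slope a \<longleftrightarrow> (\<forall>b c. distinct [0, 1, a, b, c] \<longrightarrow> slopes_occur a b c)"

lemma universal_slope_one_minus:
  assumes "universal_slope a"
  shows "universal_slope (1 - a)"
  unfolding universal_slope_def
proof (intro allI impI)
  fix b c assume "distinct [0, 1, 1 - a, b, c]"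
  then have "distinct [0, 1, a, 1 - b, 1 - c]" by auto
  then have "slopes_occur a (1 - b) (1 - c)" using assms by (simp only: universal_slope_def)
  from slopes_occur_one_minus[OF this] show "slopes_occur (1 - a) b c" by simp
qed

lemma universal_slope_inverse:
  assumes "universal_slope a" "a * a' = 1"
  shows "universal_slope a'"
  unfolding universal_slope_def
proof (intro allI impI)
  fix b c assume distinct: "distinct [0, 1, a', b, c]"
  have "a \<noteq> 0" using assms(2) by auto
  then have a': "a' = 1 / a" using assms(2) by (simp add: eq_divide_eq mult.commute)
  then have "distinct [0, 1, a, 1 / b, 1 / c]" using distinct \<open>a \<noteq> 0\<close> by auto
  then have "slopes_occur a (1 / b) (1 / c)" using assms(1) by (simp only: universal_slope_def)
  then have "slopes_occur (1 / a) (1 / (1 / b)) (1 / (1 / c))"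
    by (rule slopes_occur_inverse) (use distinct \<open>a \<noteq> 0\<close> in auto)
  then show "slopes_occur a' b c" by (simp add: a')
qed

lemma universal_slope_large:
  fixes a :: "'a::{finite_field,field_gcd}"
  assumes q: "odd (CARD('a))" "CARD('a) = CHAR('a) ^ n" "CARD('a) \<ge> 149"
  shows "universal_slope a"
  unfolding universal_slope_def
proof (intro allI impI)
  fix b c :: 'a assume distinct: "distinct [0, 1, a, b, c]"
  define \<sigma> where "\<sigma> r = (if r \<in> {0, 1} then quad_char (c - r) else - quad_char (c - r))" for r
  have "sqrt (CARD('a)) \<ge> 12.2" using q(3) by (intro real_le_rsqrt) (simp add: power2_eq_square)
  then have "(sqrt (CARD('a)) - 5)^2 \<ge> 7.2^2" by (intro power_mono) auto
  then have "16 + 10 * sqrt (CARD('a)) + 7 < CARD('a)" by (simp add: power2_eq_square algebra_simps)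
  moreover have "\<bar>\<sigma> r\<bar> = 1" if "r \<in> {0, 1, a, b}" for r
    using that distinct by (auto simp: \<sigma>_def abs_quad_char)
  ultimately have "\<exists>s. s \<notin> {0, 1} \<and> (\<forall>r\<in>{0, 1, a, b}. s = r \<or> quad_char (s - r) = \<sigma> r)"
    using distinct by (intro sign_pattern_exists[OF q(1,2)]) auto
  then obtain s where "s \<notin> {0, 1}" "\<forall>r\<in>{0, 1, a, b}. s = r \<or> quad_char (s - r) = \<sigma> r" by blast
  then have "companion_slope a b c s" using distinct by (auto simp: companion_slope_def \<sigma>_def)
  then show "slopes_occur a b c"
    using distinct by (intro slopes_occur_if_companion_slope[OF q(1)]) auto
qed

lemma orthomorphism_through_triangle:
  fixes a b c :: "'a::field"
  assumes "slopes_occur a b c" "a \<noteq> b" and "x1 \<noteq> x2"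
    and slopes: "y3 - y2 = a * (x3 - x2)" "y3 - y1 = b * (x3 - x1)" "y2 - y1 = c * (x2 - x1)"
  shows "\<exists>f. orthomorphism f \<and> f x1 = y1 \<and> f x2 = y2 \<and> f x3 = y3"
  using assms(1)
proof (rule slopes_occurE)
  fix f x y z
  assume f: "orthomorphism f" "distinct [x, y, z]"
    "f z - f y = a * (z - y)" "f z - f x = b * (z - x)" "f y - f x = c * (y - x)"
  define l where "l = (x2 - x1) / (y - x)"
  have l: "l \<noteq> 0" and scale_y: "l * (y - x) = x2 - x1" using \<open>x1 \<noteq> x2\<close> f(2) by (auto simp: l_def)
  have "(b - a) * (z - x) = (c - a) * (y - x)" using f(3-5) by Groebner_Basis.algebra
  moreover have "(b - a) * (x3 - x1) = (c - a) * (x2 - x1)" using slopes by Groebner_Basis.algebra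
  ultimately have "(b - a) * (l * (z - x)) = (b - a) * (x3 - x1)"
    using scale_y by Groebner_Basis.algebra
  then have scale_z: "l * (z - x) = x3 - x1" using \<open>a \<noteq> b\<close> by simp
  define g where "g u = (y1 - l * f x) + l * f ((u - (x1 - l * x)) / l)" for u
  have g: "g (x1 + l * (w - x)) = y1 + l * (f w - f x)" for w
    using l by (simp add: g_def algebra_simps)
  have "l * (f y - f x) = y2 - y1" "l * (f z - f x) = y3 - y1"
    unfolding f(4,5) slopes(2,3) scale_y[symmetric] scale_z[symmetric] by (simp_all add: mult_ac)
  then have "g x1 = y1" "g x2 = y2" "g x3 = y3"
    using g[of x] g[of y] g[of z] unfolding scale_y scale_z by simp_all
  moreover have "orthomorphism g" unfolding g_def by (rule orthomorphism_affine[OF f(1) l])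
  ultimately show ?thesis by blast
qed

theorem orthomorphism_extension:
  fixes x1 :: "'a::field"
  assumes universal: "\<And>a::'a. universal_slope a"
    and x: "distinct [x1, x2, x3]" and y: "distinct [y1, y2, y3]"
    and diff: "distinct [y1 - x1, y2 - x2, y3 - x3]"
  shows "\<exists>f. orthomorphism f \<and> f x1 = y1 \<and> f x2 = y2 \<and> f x3 = y3"
proof -
  define a b c where "a = (y3 - y2) / (x3 - x2)" and "b = (y3 - y1) / (x3 - x1)"
    and "c = (y2 - y1) / (x2 - x1)"
  have slopes: "y3 - y2 = a * (x3 - x2)" "y3 - y1 = b * (x3 - x1)" "y2 - y1 = c * (x2 - x1)"
    using x by (auto simp: a_def b_def c_def)
  have not_0: "a \<noteq> 0" "b \<noteq> 0" "c \<noteq> 0" using slopes y by auto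
  have not_1: "a \<noteq> 1" "b \<noteq> 1" "c \<noteq> 1" using slopes diff by (auto simp: algebra_simps)
  show ?thesis
  proof (cases "b = c")
    case True
    define f where "f u = y1 + 1 * (b * ((u - x1) / 1))" for u
    have "orthomorphism f"
      unfolding f_def
      by (rule orthomorphism_affine[OF orthomorphism_linear[OF not_0(2) not_1(2)]]) simp
    moreover have "f x1 = y1" "f x2 = y2" "f x3 = y3"
      using slopes(2)[symmetric] slopes(3)[symmetric, folded True] by (simp_all add: f_def)
    ultimately show ?thesis by blast
  next
    case False
    have "(b - a) * (x3 - x1) = (c - a) * (x2 - x1)" "(b - a) * (x3 - x2) = (b - c) * (x1 - x2)"
      using slopes by Groebner_Basis.algebra+
    then have "a \<noteq> b" "a \<noteq> c" using False x by auto
    then have "slopes_occur a b c"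
      using universal[of a] not_0 not_1 False unfolding universal_slope_def by auto
    then show ?thesis using \<open>a \<noteq> b\<close> x slopes by (intro orthomorphism_through_triangle) auto
  qed
qed

section \<open>Small primes\<close>

text \<open>
  The slopes \<open>s\<close> with given signs of \<open>s\<close> and \<open>s - 1\<close> form a quadrant \<open>Q\<close>; the column of a slope
  \<open>r\<close> lists the signs of \<open>s - r\<close> for \<open>s\<close> in \<open>Q\<close>. Then \<open>c\<close> in \<open>Q\<close> has a companion for \<open>a\<close> and \<open>b\<close>
  as soon as the columns of \<open>a\<close> and \<open>b\<close> show, in some common position, the pair of signs opposite
  to that of \<open>c\<close>.

  Some functions match on Boolean arguments where an \<open>if\<close> would be more natural: they are evaluated
  by the simplifier, which normalises an argument only once but the branches of an \<open>if\<close> again.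
\<close>

definition square_table :: "int \<Rightarrow> bool list" where
  "square_table p = foldr (\<lambda>j R. R[nat (j * j mod p) := True])
     [1..(p - 1) div 2] (replicate (nat p) False)"

fun select :: "bool list \<Rightarrow> 'b list \<Rightarrow> 'b list" where
  "select (True # m) (x # xs) = x # select m xs"
| "select (False # m) (_ # xs) = select m xs"
| "select _ _ = []"

fun columns :: "bool list \<Rightarrow> int list \<Rightarrow> bool list \<Rightarrow> (int \<times> bool list) list" where
  "columns m (r # rs) (x # X) = (r, select m (x # X)) # columns m rs X"
| "columns _ _ _ = []"

fun quadrant_mask :: "bool list \<Rightarrow> bool \<times> bool \<Rightarrow> bool list" where
  "quadrant_mask R (x, y) = map2 (\<lambda>u v. u = x \<and> v = y) (drop 2 R) (tl R)"

type_synonym quadrant = "int list \<times> (int \<times> bool list) list"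

text \<open>
  The column of \<open>r\<close> is read off \<open>R @ R\<close> from position \<open>p + 2 - r\<close> on, so the columns for decreasing
  \<open>r\<close> are obtained by dropping one entry at a time.
\<close>

definition quadrant :: "int list \<Rightarrow> bool list \<Rightarrow> bool list \<Rightarrow> quadrant" where
  "quadrant S X m = (select m S, columns m (rev S) X)"

definition quadrants :: "int list \<Rightarrow> bool list \<Rightarrow> quadrant list" where
  "quadrants S R = map (quadrant S (drop 3 (R @ R))) (map (quadrant_mask R)
     [(True, True), (True, False), (False, True), (False, False)])"

fun occurs :: "bool \<Rightarrow> bool \<Rightarrow> bool list \<Rightarrow> bool list \<Rightarrow> bool" where
  "occurs True True (True # u) (True # v) = True"
| "occurs True False (True # u) (False # v) = True"
| "occurs False True (False # u) (True # v) = True"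
| "occurs False False (False # u) (False # v) = True"
| "occurs x y (_ # u) (_ # v) = occurs x y u v"
| "occurs _ _ _ _ = False"

fun missed_unless :: "bool \<Rightarrow> bool \<Rightarrow> bool \<Rightarrow> bool \<Rightarrow> int list \<Rightarrow> bool list \<Rightarrow> bool list \<Rightarrow> int list" where
  "missed_unless True True True True Q u v = []"
| "missed_unless _ _ _ _ Q u v = [c. (c, x, y) \<leftarrow> zip Q (zip u v), \<not> occurs (\<not> x) (\<not> y) u v]"

definition missed :: "int list \<Rightarrow> bool list \<Rightarrow> bool list \<Rightarrow> int list" where
  "missed Q u v = missed_unless (occurs True True u v) (occurs True False u v)
     (occurs False True u v) (occurs False False u v) Q u v"

fun column_failures :: "int list \<Rightarrow> bool list \<Rightarrow> int \<times> bool list \<Rightarrow> (int \<times> int) list" where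
  "column_failures Q u (b, v) = map (Pair b) (missed Q u v)"

definition column :: "(int \<times> bool list) list \<Rightarrow> int \<Rightarrow> bool list" where
  "column C a = concat [v. (b, v) \<leftarrow> C, b = a]"

fun quadrant_failures :: "int \<Rightarrow> quadrant \<Rightarrow> (int \<times> int) list" where
  "quadrant_failures a (Q, C) = concat (map (column_failures Q (column C a)) C)"

definition failures :: "quadrant list \<Rightarrow> int \<Rightarrow> (int \<times> int) list" where
  "failures qs a = [(b, c). (b, c) \<leftarrow> concat (map (quadrant_failures a) qs), distinct [a, b, c]]"

fun if_reverse_in :: "(int \<times> int) list \<Rightarrow> int \<times> int \<Rightarrow> (int \<times> int) list" where
  "if_reverse_in F (b, c) = (if b < c then if (c, b) \<in> set F then [(b, c)] else [] else [])"

definition two_sided :: "(int \<times> int) list \<Rightarrow> (int \<times> int) list" where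
  "two_sided F = concat (map (if_reverse_in F) F)"

fun resolved :: "quadrant list \<Rightarrow> (int \<times> int \<times> int) list \<Rightarrow> int \<Rightarrow> int \<times> int \<Rightarrow> bool" where
  "resolved qs T a (b, c) \<longleftrightarrow>
     (c, a) \<notin> set (failures qs b) \<or> (a, b, c) \<in> set T \<or> (a, c, b) \<in> set T"

definition slope_ok :: "quadrant list \<Rightarrow> (int \<times> int \<times> int) list \<Rightarrow> int \<Rightarrow> bool" where
  "slope_ok qs T a \<longleftrightarrow> list_all (resolved qs T a) (two_sided (failures qs a))"

definition slopes_ok :: "int \<Rightarrow> (int \<times> int \<times> int) list \<Rightarrow> int list \<Rightarrow> bool list \<Rightarrow> bool" where
  "slopes_ok p T as R \<longleftrightarrow> list_all (slope_ok (quadrants [2..p - 1] R) T) as"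

text \<open>
  A table \<open>(a, b, c, z, fs)\<close> describes the orthomorphism with values \<open>fs ! i\<close>, in which the points
  over \<open>0\<close>, \<open>1\<close>, \<open>z\<close> form a triangle with slopes \<open>a\<close>, \<open>b\<close>, \<open>c\<close>.
\<close>

type_synonym table = "int \<times> int \<times> int \<times> int \<times> int list"

fun table_ok :: "int \<Rightarrow> table \<Rightarrow> bool" where
  "table_ok p (a, b, c, z, fs) \<longleftrightarrow> length fs = nat p \<and> distinct (map (\<lambda>v. v mod p) fs) \<and>
     distinct (map2 (\<lambda>i v. (v - i) mod p) [0..p - 1] fs) \<and> 1 < z \<and> z < p \<and>
     (fs ! 1 - fs ! 0 - c) mod p = 0 \<and> (fs ! nat z - fs ! 0 - b * z) mod p = 0 \<and>
     (fs ! nat z - fs ! 1 - a * (z - 1)) mod p = 0"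

fun slope_orbit :: "int \<Rightarrow> int \<times> int \<times> int \<Rightarrow> int list" where
  "slope_orbit p (a, a', a'') = [a, p + 1 - a, a', p + 1 - a', a'', p + 1 - a'']"

text \<open>
  In a certificate \<open>(p, A, E)\<close> the entries of \<open>A\<close> have the form \<open>(a, 1/a, 1/(1 - a))\<close>, where \<open>a\<close>
  runs through representatives of the orbits of \<open>m \<mapsto> 1 - m\<close> and \<open>m \<mapsto> 1/m\<close> on the slopes; \<open>E\<close>
  covers the triples without a companion slope.
\<close>

type_synonym certificate = "int \<times> (int \<times> int \<times> int) list \<times> table list"

fun valid_certificate :: "certificate \<Rightarrow> bool" where
  "valid_certificate (p, A, E) \<longleftrightarrow>
     list_all (\<lambda>(a, a', a''). 1 < a \<and> a < p \<and> a * a' mod p = 1 \<and> (1 - a) * a'' mod p = 1) A \<and>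
     set [2..p - 1] \<subseteq> set (concat (map (slope_orbit p) A)) \<and>
     list_all (table_ok p) E \<and>
     slopes_ok p (map (\<lambda>(a, b, c, _). (a, b, c)) E) (map fst A) (square_table p)"

definition certificates_below_103 :: "certificate list" where
  "certificates_below_103 =
   [(11, [(2, 6, 10), (4, 3, 7)], [(2, 3, 7, 5, [0, 7, 6, 8, 2, 4, 3, 10, 9, 5, 1]), (4, 5, 8,
      4, [0, 8, 4, 6, 9, 2, 1, 5, 7, 10, 3]), (4, 5, 9, 5, [0, 9, 4, 8, 5, 3, 1, 10, 7, 2, 6]),
      (4, 6, 8, 2, [0, 8, 1, 4, 6, 9, 3, 10, 2, 7, 5]), (4, 7, 8, 5, [0, 8, 3, 5, 10, 2, 9, 6,
      1, 7, 4]), (4, 7, 9, 9, [0, 9, 7, 5, 2, 6, 1, 10, 4, 8, 3])]),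
    (13, [(2, 7, 12), (3, 9, 6), (4, 10, 4)], [(2, 4, 10, 4, [0, 10, 8, 6, 3, 2, 1, 9, 12, 7,
      11, 5, 4]), (2, 7, 12, 2, [0, 12, 1, 7, 9, 2, 8, 10, 3, 5, 11, 4, 6]), (3, 5, 6, 8, [0, 6,
      10, 2, 5, 7, 3, 11, 1, 12, 4, 9, 8]), (4, 2, 10, 10, [0, 10, 6, 4, 12, 3, 11, 9, 2, 8, 7,
      1, 5]), (4, 7, 10, 2, [0, 10, 1, 8, 7, 9, 3, 2, 6, 11, 4, 12, 5]), (4, 10, 12, 10, [0, 12,
      4, 8, 10, 1, 7, 11, 5, 3, 9, 6, 2])]),
    (17, [(2, 9, 16), (3, 6, 8), (4, 13, 11)], [(2, 9, 16, 2, [0, 16, 1, 6, 13, 10, 8, 15, 14,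
      4, 11, 5, 9, 3, 7, 2, 12]), (3, 8, 12, 12, [0, 12, 14, 1, 8, 7, 3, 16, 9, 15, 13, 2, 11,
      6, 10, 5, 4])]),
    (19, [(2, 10, 18), (4, 5, 6), (11, 7, 17), (12, 8, 12)], []),
    (23, [(2, 12, 22), (5, 14, 17), (6, 4, 9), (8, 3, 13)], [(8, 13, 21, 21, [0, 21, 17, 8, 5,
      13, 15, 11, 14, 3, 6, 1, 19, 4, 16, 2, 9, 12, 7, 22, 18, 20, 10])]),
    (29, [(2, 15, 28), (3, 10, 14), (4, 22, 19), (5, 6, 7), (9, 13, 18)], [(2, 15, 28, 2, [0,
      28, 1, 12, 25, 6, 17, 2, 4, 21, 18, 15, 22, 16, 20, 8, 7, 5, 3, 24, 27, 10, 9, 13, 26, 19,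
      23, 11, 14])]),
    (31, [(2, 16, 30), (5, 25, 23), (6, 26, 6), (8, 4, 22), (12, 13, 14), (17, 11, 29)], [(2,
      16, 30, 2, [0, 30, 1, 10, 19, 23, 25, 21, 24, 12, 16, 7, 4, 17, 3, 5, 26, 22, 11, 13, 28,
      18, 2, 14, 6, 20, 27, 29, 9, 15, 8])]),
    (37, [(2, 19, 36), (3, 25, 18), (4, 28, 12), (5, 15, 9), (6, 31, 22), (8, 14, 21), (11, 27,
      11)], []),
    (41, [(2, 21, 40), (3, 14, 20), (4, 31, 27), (5, 33, 10), (6, 7, 8), (12, 24, 26), (13, 19,
      17)], [(2, 21, 40, 2, [0, 40, 1, 38, 12, 37, 15, 36, 39, 13, 33, 29, 19, 6, 11, 27, 21, 3,
      34, 8, 30, 24, 17, 25, 35, 31, 2, 28, 20, 9, 4, 16, 10, 5, 7, 14, 32, 18, 22, 26, 23])]),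
    (43, [(2, 22, 42), (3, 29, 21), (10, 13, 19), (11, 4, 30), (12, 18, 39), (24, 9, 28), (27,
      8, 38), (37, 7, 37)], []),
    (47, [(2, 24, 46), (3, 16, 23), (5, 19, 35), (6, 8, 28), (7, 27, 39), (10, 33, 26), (12, 4,
      17), (30, 11, 34)], []),
    (53, [(2, 27, 52), (3, 18, 26), (4, 40, 35), (5, 32, 13), (6, 9, 21), (7, 38, 44), (8, 20,
      15), (11, 29, 37), (12, 31, 24)], []),
    (59, [(2, 30, 58), (3, 20, 29), (5, 12, 44), (6, 10, 47), (8, 37, 42), (9, 46, 22), (11, 43,
      53), (15, 4, 21), (24, 32, 41), (25, 26, 27)], []),
    (61, [(2, 31, 60), (3, 41, 30), (4, 46, 20), (5, 49, 15), (6, 51, 12), (7, 35, 10), (8, 23,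
      26), (9, 34, 38), (14, 48, 14), (17, 18, 19), (22, 25, 29)], []),
    (67, [(2, 34, 66), (3, 45, 33), (4, 17, 22), (5, 27, 50), (6, 56, 40), (7, 48, 11), (8, 42,
      19), (9, 15, 25), (10, 47, 52), (13, 31, 39), (14, 24, 36), (30, 38, 30)], []),
    (71, [(2, 36, 70), (3, 24, 35), (4, 18, 47), (5, 57, 53), (6, 12, 14), (7, 61, 59), (8, 9,
      10), (16, 40, 52), (17, 46, 31), (21, 44, 39), (22, 42, 27), (23, 34, 29)], []),
    (73, [(2, 37, 72), (3, 49, 36), (4, 55, 24), (5, 44, 18), (6, 61, 29), (7, 21, 12), (8, 64,
      52), (9, 65, 9), (11, 20, 51), (14, 47, 28), (15, 39, 26), (16, 32, 34), (17, 43, 41)],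
      []),
    (79, [(2, 40, 78), (3, 53, 39), (4, 20, 26), (5, 16, 59), (6, 66, 63), (7, 34, 13), (8, 10,
      45), (9, 44, 69), (12, 33, 43), (15, 58, 62), (19, 25, 57), (24, 56, 24), (28, 48, 38),
      (29, 30, 31)], []),
    (83, [(2, 42, 82), (3, 28, 41), (4, 21, 55), (5, 50, 62), (6, 14, 33), (7, 12, 69), (8, 52,
      71), (9, 37, 31), (10, 25, 46), (11, 68, 58), (17, 44, 57), (18, 60, 39), (19, 35, 23),
      (20, 54, 48)], []),
    (89, [(2, 45, 88), (3, 30, 44), (4, 67, 59), (5, 18, 22), (6, 15, 71), (7, 51, 74), (8, 78,
      38), (9, 10, 11), (13, 48, 37), (14, 70, 41), (17, 21, 50), (24, 26, 58), (25, 57, 63),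
      (28, 35, 56), (29, 43, 54)], []),
    (97, [(2, 49, 96), (3, 65, 48), (4, 73, 32), (5, 39, 24), (6, 81, 58), (7, 14, 16), (8, 85,
      83), (9, 54, 12), (10, 68, 43), (11, 53, 29), (18, 27, 57), (19, 46, 70), (20, 34, 51),
      (21, 37, 63), (22, 75, 60), (26, 56, 31), (36, 62, 36)], []),
    (101, [(2, 51, 100), (3, 34, 50), (4, 76, 67), (5, 81, 25), (6, 17, 20), (7, 29, 84), (8,
      38, 72), (9, 45, 63), (10, 91, 56), (12, 59, 55), (13, 70, 42), (14, 65, 31), (15, 27,
      36), (16, 19, 74), (22, 23, 24), (33, 49, 41), (40, 48, 44)], [])]"

definition certificates_from_103 :: "certificate list" where
  "certificates_from_103 =
   [(103, [(2, 52, 102), (3, 69, 51), (4, 26, 34), (5, 62, 77), (6, 86, 41), (7, 59, 17), (8,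
      13, 44), (9, 23, 90), (10, 31, 80), (11, 75, 72), (12, 43, 28), (15, 55, 22), (19, 38,
      40), (20, 67, 65), (21, 54, 36), (25, 33, 30), (56, 46, 88), (57, 47, 57)], []),
    (107, [(2, 54, 106), (3, 36, 53), (4, 27, 71), (5, 43, 80), (6, 18, 64), (7, 46, 89), (8,
      67, 61), (9, 12, 40), (10, 75, 95), (11, 39, 32), (14, 23, 74), (15, 50, 84), (16, 87,
      57), (17, 63, 20), (22, 73, 56), (25, 30, 49), (26, 70, 77), (29, 48, 42)], []),
    (109, [(2, 55, 108), (3, 73, 54), (4, 82, 36), (5, 22, 27), (6, 91, 87), (7, 78, 18), (8,
      41, 31), (9, 97, 68), (10, 11, 12), (14, 39, 67), (15, 80, 70), (16, 75, 29), (17, 77,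
      34), (20, 60, 86), (21, 26, 49), (25, 48, 59), (38, 66, 53), (45, 63, 52), (46, 64, 46)],
      []),
    (113, [(2, 57, 112), (3, 38, 56), (4, 85, 75), (5, 68, 28), (6, 19, 45), (7, 97, 94), (8,
      99, 16), (9, 88, 14), (10, 34, 25), (11, 72, 79), (12, 66, 41), (13, 87, 47), (18, 44,
      93), (22, 36, 43), (23, 59, 77), (24, 33, 54), (30, 49, 74), (31, 62, 64), (32, 53, 51)],
      []),
    (127, [(2, 64, 126), (3, 85, 63), (4, 32, 42), (5, 51, 95), (6, 106, 76), (7, 109, 21), (8,
      16, 18), (9, 113, 111), (10, 89, 14), (11, 104, 38), (12, 53, 23), (13, 88, 74), (20, 108,
      20), (25, 61, 37), (26, 44, 66), (27, 80, 83), (28, 59, 47), (29, 92, 68), (30, 72, 35),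
      (31, 41, 55), (34, 71, 50), (46, 58, 79)], []),
    (131, [(2, 66, 130), (3, 44, 65), (4, 33, 87), (5, 105, 98), (6, 22, 26), (7, 75, 109), (8,
      82, 56), (9, 102, 49), (10, 118, 29), (11, 12, 13), (15, 35, 28), (16, 41, 96), (17, 54,
      90), (18, 51, 77), (19, 69, 80), (20, 59, 62), (21, 25, 72), (24, 71, 74), (31, 93, 48),
      (32, 86, 38), (37, 85, 40), (43, 64, 53)], []),
    (137, [(2, 69, 136), (3, 46, 68), (4, 103, 91), (5, 55, 34), (6, 23, 82), (7, 98, 114), (8,
      120, 39), (9, 61, 17), (10, 96, 76), (11, 25, 41), (12, 80, 112), (13, 116, 57), (14, 49,
      21), (15, 64, 88), (16, 60, 73), (19, 101, 38), (20, 48, 36), (27, 66, 79), (28, 93, 71),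
      (29, 52, 44), (30, 32, 85), (31, 84, 105), (43, 51, 75)], []),
    (139, [(2, 70, 138), (3, 93, 69), (4, 35, 46), (5, 28, 104), (6, 116, 111), (7, 20, 23), (8,
      87, 119), (9, 31, 52), (10, 14, 108), (11, 38, 125), (12, 58, 101), (13, 107, 81), (16,
      113, 37), (17, 90, 26), (18, 85, 49), (19, 22, 54), (25, 89, 110), (34, 45, 80), (40, 73,
      57), (41, 78, 66), (42, 96, 61), (43, 97, 43), (48, 84, 68), (63, 64, 65)], [])]"

lemma length_square_table: "length (square_table p) = nat p"
proof -
  have "length (foldr (\<lambda>j R. R[g j := True]) js R0) = length R0" for g :: "int \<Rightarrow> nat" and js R0
    by (induction js) simp_all
  then show ?thesis by (simp add: square_table_def)
qed

lemma nth_square_table: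
  assumes "0 \<le> k" "k < p"
  shows "square_table p ! nat k \<longleftrightarrow> k \<in> (\<lambda>j. j * j mod p) ` {1..(p - 1) div 2}"
proof -
  have "foldr (\<lambda>j R. R[g j := True]) js R0 ! i \<longleftrightarrow> i \<in> g ` set js \<or> R0 ! i" if "i < length R0"
    for g :: "int \<Rightarrow> nat" and js R0 i
  proof (induction js)
    case (Cons j js)
    have "length (foldr (\<lambda>j R. R[g j := True]) js R0) = length R0" by (induction js) simp_all
    then show ?case using Cons that by (cases "i = g j") (auto simp: nth_list_update)
  qed simp
  then have "square_table p ! nat k \<longleftrightarrow> nat k \<in> (\<lambda>j. nat (j * j mod p)) ` {1..(p - 1) div 2}"
    using assms unfolding square_table_def by auto
  also have "\<dots> \<longleftrightarrow> k \<in> (\<lambda>j. j * j mod p) ` {1..(p - 1) div 2}"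
    using assms by (auto simp: image_iff eq_nat_nat_iff)
  finally show ?thesis .
qed

lemma select_eq_map:
  assumes "length m = length S" "length S \<le> length X" "\<And>i. i < length S \<Longrightarrow> X ! i = g (S ! i)"
  shows "select m X = map g (select m S)"
  using assms
proof (induction m S arbitrary: X rule: list_induct2)
  case (Cons e m s S)
  then obtain x X' where X: "X = x # X'" by (cases X) auto
  have "select m X' = map g (select m S)"
    using Cons.prems(1) Cons.prems(2)[of "Suc _"] unfolding X by (intro Cons.IH) auto
  then show ?case using Cons.prems(2)[of 0] unfolding X by (cases e) simp_all
qed simp

lemma select_eq_filter: "select m xs = map snd (filter fst (zip m xs))"
  by (induction m xs rule: select.induct) auto

lemma set_select:
  assumes "length m = length xs"
  shows "set (select m xs) = {xs ! i | i. i < length xs \<and> m ! i}"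
  using assms by (force simp: select_eq_filter set_zip)

lemma columns_nth:
  "i < length rs \<Longrightarrow> i < length X \<Longrightarrow> (rs ! i, select m (drop i X)) \<in> set (columns m rs X)"
proof (induction m rs X arbitrary: i rule: columns.induct)
  case (1 m r rs x X)
  then show ?case by (cases i) auto
qed auto

lemma column_columns:
  assumes "distinct (map fst C)" "(a, u) \<in> set C"
  shows "column C a = u"
  using assms
proof (induction C)
  case (Cons t C)
  obtain b v where t: "t = (b, v)" by (cases t)
  show ?case
  proof (cases "b = a")
    case True
    then have "[w. (b, w) \<leftarrow> C, b = a] = []"
      using Cons.prems(1) t by (force simp: concat_eq_Nil_conv)
    then show ?thesis using True Cons.prems t by (force simp: column_def)
  next
    case False
    then show ?thesis using Cons t by (auto simp: column_def)
  qed
qed simp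

lemma map_fst_columns: "length rs \<le> length X \<Longrightarrow> map fst (columns m rs X) = rs"
  by (induction m rs X rule: columns.induct) auto

lemma occurs_iff: "occurs x y u v \<longleftrightarrow> (x, y) \<in> set (zip u v)"
  by (induction x y u v rule: occurs.induct) auto

lemma occurs_map: "occurs x y (map f Q) (map g Q) \<longleftrightarrow> (\<exists>s\<in>set Q. f s = x \<and> g s = y)"
proof -
  have "zip (map f Q) (map g Q) = map (\<lambda>s. (f s, g s)) Q" by (induction Q) simp_all
  then show ?thesis by (auto simp: occurs_iff)
qed

lemma missed_eq: "missed Q u v = [c. (c, x, y) \<leftarrow> zip Q (zip u v), \<not> occurs (\<not> x) (\<not> y) u v]"
proof (cases "\<forall>x y. occurs x y u v")
  case True
  then show ?thesis by (auto simp: missed_def intro!: concat_eq_Nil_conv[THEN iffD2])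
next
  case False
  then have "\<not> (occurs True True u v \<and> occurs True False u v \<and>
      occurs False True u v \<and> occurs False False u v)"
    by (metis (full_types))
  then show ?thesis
    by (cases "occurs True True u v"; cases "occurs True False u v"; cases "occurs False True u v";
        cases "occurs False False u v") (simp_all add: missed_def)
qed

lemma set_missed_map:
  "set (missed Q (map f Q) (map g Q)) = {c \<in> set Q. \<not> (\<exists>s\<in>set Q. f s \<noteq> f c \<and> g s \<noteq> g c)}"
proof -
  have "zip Q (zip (map f Q) (map g Q)) = map (\<lambda>s. (s, f s, g s)) Q" by (induction Q) simp_all
  then show ?thesis by (auto simp: missed_eq occurs_map)
qed

lemma set_failures:
  "set (failures qs a) = {(b, c). distinct [a, b, c] \<and>
     (\<exists>q\<in>set qs. (b, c) \<in> set (quadrant_failures a q))}"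
  unfolding failures_def by auto

locale residue_list =
  fixes p :: int and R :: "bool list" and sq :: "int \<Rightarrow> bool"
  assumes p_gt_2: "p > 2" and length_R: "length R = nat p"
    and nth_R: "0 \<le> k \<Longrightarrow> k < p \<Longrightarrow> R ! nat k = sq k" and sq_mod: "sq (k mod p) = sq k"
begin

abbreviation slopes :: "int list" where "slopes \<equiv> [2..p - 1]"

lemma nth_double_R:
  assumes "0 \<le> s" "s < p" "0 \<le> r" "r < p"
  shows "(R @ R) ! nat (p + s - r) = sq (s - r)"
proof (cases "s < r")
  case True
  have "(p + s - r) mod p = (s - r) mod p" by (simp add: add_diff_eq[symmetric])
  then have "sq (p + s - r) = sq (s - r)" by (metis sq_mod)
  then show ?thesis using assms True nth_R[of "p + s - r"] length_R by (simp add: nth_append)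
next
  case False
  then have "nat (p + s - r) - length R = nat (s - r)" using assms length_R by simp
  then show ?thesis using assms False nth_R[of "s - r"] length_R by (simp add: nth_append)
qed

abbreviation quadrant_of :: "bool list \<Rightarrow> quadrant" where
  "quadrant_of m \<equiv> quadrant slopes (drop 3 (R @ R)) m"

abbreviation shifted :: "bool list \<Rightarrow> int \<Rightarrow> bool list" where
  "shifted m r \<equiv> map (\<lambda>s. sq (s - r)) (select m slopes)"

lemma select_shift:
  assumes "length m = length slopes" "r \<in> set slopes"
  shows "select m (drop (nat (p + 2 - r)) (R @ R)) = shifted m r"
proof (rule select_eq_map[OF assms(1)])
  show "length slopes \<le> length (drop (nat (p + 2 - r)) (R @ R))"
    using assms(2) p_gt_2 length_R by auto
  fix i assume i: "i < length slopes"
  have "drop (nat (p + 2 - r)) (R @ R) ! i = (R @ R) ! nat (p + (2 + int i) - r)"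
    using assms(2) p_gt_2 i length_R
    by (subst nth_drop)
      (auto simp: nat_add_distrib algebra_simps intro!: arg_cong[where f = "(!) (R @ R)"])
  also have "\<dots> = sq (slopes ! i - r)"
    using nth_double_R[of "2 + int i" r] assms(2) i by auto
  finally show "drop (nat (p + 2 - r)) (R @ R) ! i = sq (slopes ! i - r)" .
qed

lemma quadrant_columns:
  assumes "length m = length slopes" "r \<in> set slopes"
  shows "column (snd (quadrant_of m)) r = shifted m r"
    and "(r, shifted m r) \<in> set (snd (quadrant_of m))"
proof -
  let ?i = "nat (p - 1 - r)"
  have "rev slopes ! ?i = r" using assms(2) by (subst rev_nth) (auto simp: nat_diff_distrib)
  moreover have "drop ?i (drop 3 (R @ R)) = drop (nat (p + 2 - r)) (R @ R)"
  proof -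
    have "?i + 3 = nat (p + 2 - r)" using assms(2) by auto
    then show ?thesis by (simp only: drop_drop)
  qed
  moreover have "(rev slopes ! ?i, select m (drop ?i (drop 3 (R @ R))))
      \<in> set (columns m (rev slopes) (drop 3 (R @ R)))"
    using assms(2) length_R by (intro columns_nth) auto
  ultimately show member: "(r, shifted m r) \<in> set (snd (quadrant_of m))"
    unfolding quadrant_def snd_conv by (simp only: select_shift[OF assms])
  have "map fst (snd (quadrant_of m)) = rev slopes"
    using length_R p_gt_2 by (simp add: quadrant_def map_fst_columns)
  then have "distinct (map fst (snd (quadrant_of m)))" by simp
  then show "column (snd (quadrant_of m)) r = shifted m r"
    using member by (rule column_columns)
qed

lemma length_quadrant_mask: "length (quadrant_mask R xy) = length slopes"
  using length_R p_gt_2 by (cases xy) simp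

lemma set_select_quadrant_mask:
  "set (select (quadrant_mask R (x, y)) slopes) = {s \<in> set slopes. sq s = x \<and> sq (s - 1) = y}"
proof -
  have mask: "quadrant_mask R (x, y) ! i \<longleftrightarrow> sq (slopes ! i) = x \<and> sq (slopes ! i - 1) = y"
    if "i < length slopes" for i
  proof -
    have "drop 2 R ! i = sq (2 + int i)" "tl R ! i = sq (1 + int i)"
      using that p_gt_2 length_R nth_R[of "2 + int i"] nth_R[of "1 + int i"]
      by (simp_all add: nth_tl nat_add_distrib)
    then show ?thesis using that length_R p_gt_2 by simp
  qed
  show ?thesis
    unfolding set_select[OF length_quadrant_mask] using mask by (auto simp: set_conv_nth)
qed

lemma failures_complete:
  assumes "a \<in> set slopes" "b \<in> set slopes" "c \<in> set slopes" "distinct [a, b, c]"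
    and "(b, c) \<notin> set (failures (quadrants slopes R) a)"
  shows "\<exists>s\<in>set slopes. sq s = sq c \<and> sq (s - 1) = sq (c - 1) \<and>
    sq (s - a) \<noteq> sq (c - a) \<and> sq (s - b) \<noteq> sq (c - b)"
proof -
  define m where "m = quadrant_mask R (sq c, sq (c - 1))"
  define Q where "Q = select m slopes"
  define q where "q = quadrant slopes (drop 3 (R @ R)) m"
  have length_m: "length m = length slopes" unfolding m_def by (rule length_quadrant_mask)
  have set_Q: "set Q = {s \<in> set slopes. sq s = sq c \<and> sq (s - 1) = sq (c - 1)}"
    unfolding Q_def m_def by (rule set_select_quadrant_mask)
  have column: "column (snd q) a = map (\<lambda>s. sq (s - a)) Q"
    "(b, map (\<lambda>s. sq (s - b)) Q) \<in> set (snd q)"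
    unfolding q_def Q_def using quadrant_columns[OF length_m] assms(1,2) by blast+
  have "q \<in> set (quadrants slopes R)"
    unfolding q_def m_def quadrants_def by (cases "sq c"; cases "sq (c - 1)") simp_all
  then have "(b, c) \<notin> set (quadrant_failures a q)"
    using assms(4,5) unfolding set_failures by blast
  moreover have "q = (Q, snd q)" by (simp add: q_def quadrant_def Q_def)
  ultimately have "(b, c) \<notin> set (quadrant_failures a (Q, snd q))" by metis
  then have "(b, c) \<notin> set (column_failures Q (map (\<lambda>s. sq (s - a)) Q) (b, map (\<lambda>s. sq (s - b)) Q))"
    using column(2) unfolding quadrant_failures.simps column(1) set_concat set_map by blast
  then have "c \<notin> set (missed Q (map (\<lambda>s. sq (s - a)) Q) (map (\<lambda>s. sq (s - b)) Q))"
    unfolding column_failures.simps by (simp add: image_iff)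
  moreover have "c \<in> set Q" using assms(3) by (simp add: set_Q)
  ultimately have "\<exists>s\<in>set Q. sq (s - a) \<noteq> sq (c - a) \<and> sq (s - b) \<noteq> sq (c - b)"
    unfolding set_missed_map by blast
  then show ?thesis unfolding set_Q by blast
qed

end

lemma of_int_mod_ring_eq_iff:
  "(of_int k :: 'a::prime_card mod_ring) = of_int l \<longleftrightarrow> k mod int (CARD('a)) = l mod int (CARD('a))"
  by (simp add: of_int_eq_iff_cong_CHAR cong_def)

lemma quad_char_eq_1_iff_square:
  assumes "odd (CARD('a::prime_card))"
  shows "quad_char (of_int k :: 'a mod_ring) = 1
    \<longleftrightarrow> k mod int (CARD('a)) \<in> (\<lambda>j. j * j mod int (CARD('a))) ` {1..(int (CARD('a)) - 1) div 2}"
proof -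
  let ?p = "int (CARD('a))" and ?of = "of_int :: int \<Rightarrow> 'a mod_ring"
  define J where "J = {1..(?p - 1) div 2}"
  have odd: "odd (CARD('a mod_ring))" using assms by simp
  have not_0: "?of j \<noteq> 0" if "0 < j" "j < ?p" for j
    using that of_int_mod_ring_eq_iff[of j 0, where 'a = 'a] by simp
  have "inj_on (\<lambda>j. ?of (j * j)) J"
  proof (rule inj_onI)
    fix i j assume ij: "i \<in> J" "j \<in> J" and "?of (i * i) = ?of (j * j)"
    then have "?of (i - j) * ?of (i + j) = 0" by (simp add: algebra_simps)
    moreover have "?of (i + j) \<noteq> 0" using ij unfolding J_def by (intro not_0) auto
    ultimately have "?of i = ?of j" by simp
    then have "i mod ?p = j mod ?p" unfolding of_int_mod_ring_eq_iff .
    moreover have "i < ?p" "j < ?p" using ij unfolding J_def by auto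
    ultimately show "i = j" using ij unfolding J_def by simp
  qed
  then have "card ((\<lambda>j. ?of (j * j)) ` J) = nat ((?p - 1) div 2)"
    unfolding J_def by (simp add: card_image)
  also have "\<dots> = (CARD('a mod_ring) - 1) div 2" using assms by (auto elim!: oddE)
  finally have "card ((\<lambda>j. ?of (j * j)) ` J) = (CARD('a mod_ring) - 1) div 2" .
  moreover have "quad_char (?of (j * j)) = 1" if "j \<in> J" for j
  proof -
    have "?of j \<noteq> 0" using that unfolding J_def by (intro not_0) auto
    then have "quad_char (?of j) * quad_char (?of j) = 1"
      using quad_char_square[OF odd] by (metis power2_eq_square)
    then show ?thesis by (simp add: quad_char_mult[OF odd])
  qed
  then have "(\<lambda>j. ?of (j * j)) ` J \<subseteq> {z. quad_char z = 1}" by auto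
  ultimately have "(\<lambda>j. ?of (j * j)) ` J = {z. quad_char z = 1}"
    using card_quad_char_eq_1_le[OF odd] by (intro card_seteq) auto
  then have "quad_char (?of k) = 1 \<longleftrightarrow> (\<exists>j\<in>J. ?of k = ?of (j * j))" by auto
  then show ?thesis unfolding of_int_mod_ring_eq_iff J_def by auto
qed

lemma residue_list_square_table:
  assumes "CARD('a::prime_card) > 2"
  shows "residue_list (int (CARD('a))) (square_table (int (CARD('a))))
    (\<lambda>k. quad_char (of_int k :: 'a mod_ring) = 1)"
proof
  have "odd (CARD('a))" using assms prime_card[where 'a = 'a] prime_odd_nat by blast
  note square = quad_char_eq_1_iff_square[OF this]
  show "int (CARD('a)) > 2" using assms by simp
  show "length (square_table (int (CARD('a)))) = nat (int (CARD('a)))" by (rule length_square_table)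
  show "square_table (int (CARD('a))) ! nat k = (quad_char (of_int k :: 'a mod_ring) = 1)"
    if "0 \<le> k" "k < int (CARD('a))" for k
    using that by (simp add: nth_square_table square)
  show "(quad_char (of_int (k mod int (CARD('a))) :: 'a mod_ring) = 1)
      = (quad_char (of_int k :: 'a mod_ring) = 1)"
    for k
    unfolding square by simp
qed

lemma companion_slopeI:
  assumes "s \<notin> {0, 1}" "c \<notin> {0, 1, a, b}"
    and "quad_char s = 1 \<longleftrightarrow> quad_char c = 1" "quad_char (s - 1) = 1 \<longleftrightarrow> quad_char (c - 1) = 1"
    and "quad_char (s - a) = 1 \<longleftrightarrow> quad_char (c - a) \<noteq> 1"
      "quad_char (s - b) = 1 \<longleftrightarrow> quad_char (c - b) \<noteq> 1"
  shows "companion_slope a b c s"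
proof -
  have eq: "quad_char z = quad_char w"
    if "z \<noteq> 0" "w \<noteq> 0" "quad_char z = 1 \<longleftrightarrow> quad_char w = 1" for z w :: 'a
    using that quad_char_cases[of z] quad_char_cases[of w] by auto
  have opposite: "quad_char z = - quad_char w"
    if "z \<noteq> 0" "w \<noteq> 0" "quad_char z = 1 \<longleftrightarrow> quad_char w \<noteq> 1" for z w :: 'a
    using that quad_char_cases[of z] quad_char_cases[of w] by auto
  show ?thesis
    unfolding companion_slope_def
  proof (intro conjI)
    show "quad_char s = quad_char c" "quad_char (s - 1) = quad_char (c - 1)"
      by (rule eq; use assms(1-4) in simp)+
    show "s = a \<or> quad_char (s - a) = - quad_char (c - a)"
      "s = b \<or> quad_char (s - b) = - quad_char (c - b)"
      using assms(2,5,6) by (metis insert_iff opposite right_minus_eq)+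
  qed (use assms(1) in auto)
qed

lemma slopes_occur_if_not_failure:
  assumes card: "p = int (CARD('a::prime_card))" "p > 2"
    and "{a, b, c} \<subseteq> {2..<p}" "distinct [a, b, c]"
    and "(b, c) \<notin> set (failures (quadrants [2..p - 1] (square_table p)) a)"
  shows "slopes_occur (of_int a :: 'a mod_ring) (of_int b) (of_int c)"
proof -
  let ?of = "of_int :: int \<Rightarrow> 'a mod_ring"
  have odd: "odd (CARD('a mod_ring))"
    using card prime_card[where 'a = 'a] prime_odd_nat[of "CARD('a)"] by simp
  interpret residue_list p "square_table p" "\<lambda>k. quad_char (?of k) = 1"
    using residue_list_square_table[where 'a = 'a] card by simp
  have "\<exists>s\<in>set slopes. (quad_char (?of s) = 1) = (quad_char (?of c) = 1)
    \<and> (quad_char (?of (s - 1)) = 1) = (quad_char (?of (c - 1)) = 1)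
    \<and> (quad_char (?of (s - a)) = 1) \<noteq> (quad_char (?of (c - a)) = 1)
    \<and> (quad_char (?of (s - b)) = 1) \<noteq> (quad_char (?of (c - b)) = 1)"
    by (rule failures_complete) (use assms(3-5) in auto)
  then obtain s where "s \<in> {2..<p}"
    and s: "(quad_char (?of s) = 1) = (quad_char (?of c) = 1)"
      "(quad_char (?of (s - 1)) = 1) = (quad_char (?of (c - 1)) = 1)"
      "(quad_char (?of (s - a)) = 1) \<noteq> (quad_char (?of (c - a)) = 1)"
      "(quad_char (?of (s - b)) = 1) \<noteq> (quad_char (?of (c - b)) = 1)" by force
  have eq_iff: "?of k = ?of l \<longleftrightarrow> k = l" if "k \<in> {0..<p}" "l \<in> {0..<p}" for k l
    using that unfolding of_int_mod_ring_eq_iff card(1)[symmetric] by simp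
  have neq: "?of k \<noteq> 0" "?of k \<noteq> 1" if "k \<in> {2..<p}" for k
    using that eq_iff[of k 0] eq_iff[of k 1] by auto
  have distinct: "?of a \<noteq> ?of b" "?of a \<noteq> ?of c" "?of b \<noteq> ?of c"
    using assms(3,4) by (auto simp: eq_iff)
  have "companion_slope (?of a) (?of b) (?of c) (?of s)"
  proof (rule companion_slopeI)
    show "?of s \<notin> {0, 1}" using neq[OF \<open>s \<in> {2..<p}\<close>] by simp
    show "?of c \<notin> {0, 1, ?of a, ?of b}" using neq[of c] assms(3) distinct by auto
  qed (use s in simp_all)
  then show ?thesis by (rule slopes_occur_if_companion_slope[OF odd distinct])
qed

lemma inj_if_distinct_residues:
  fixes h :: "'a::prime_card mod_ring \<Rightarrow> 'a mod_ring"
  assumes "length vs = CARD('a)" "distinct (map (\<lambda>v. v mod int (CARD('a))) vs)"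
    and entries: "\<And>i. i < CARD('a) \<Longrightarrow> h (of_nat i) = of_int (vs ! i)"
  shows "inj h"
proof (rule injI)
  fix u v assume "h u = h v"
  obtain i j where ij: "i < CARD('a)" "u = of_nat i" "j < CARD('a)" "v = of_nat j"
    using surj_of_nat_mod_ring by metis
  then have "map (\<lambda>v. v mod int (CARD('a))) vs ! i = map (\<lambda>v. v mod int (CARD('a))) vs ! j"
    using \<open>h u = h v\<close> assms(1) by (simp add: entries of_int_mod_ring_eq_iff)
  then have "i = j" using ij assms(1) nth_eq_iff_index_eq[OF assms(2)] by simp
  then show "u = v" using ij by simp
qed

lemma slopes_occur_if_table_ok:
  assumes "table_ok (int (CARD('a::prime_card))) (a, b, c, z, fs)"
  shows "slopes_occur (of_int a :: 'a mod_ring) (of_int b) (of_int c)"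
proof -
  let ?p = "int (CARD('a))" and ?of = "of_int :: int \<Rightarrow> 'a mod_ring"
  have len: "length fs = CARD('a)" and z: "1 < z" "z < ?p" using assms by auto
  define f where "f u = ?of (fs ! nat (to_int_mod_ring u))" for u :: "'a mod_ring"
  have f: "f (of_nat i) = ?of (fs ! i)" if "i < CARD('a)" for i
    using that unfolding f_def of_nat_of_int_mod_ring by simp
  have "inj f" by (rule inj_if_distinct_residues[of fs]) (use assms len f in auto)
  moreover have "inj (\<lambda>u. f u - u)"
    by (rule inj_if_distinct_residues[of "map2 (\<lambda>i v. v - i) [0..?p - 1] fs"])
      (use assms len f in \<open>auto simp: comp_def case_prod_unfold\<close>)
  ultimately have "orthomorphism f" unfolding orthomorphism_def by (simp add: bij_if_inj)
  have eq: "?of k = ?of l" if "(k - l) mod ?p = 0" for k l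
    using that unfolding of_int_mod_ring_eq_iff by (simp add: mod_eq_dvd_iff dvd_eq_mod_eq_0)
  have points: "f 0 = ?of (fs ! 0)" "f 1 = ?of (fs ! 1)" "f (?of z) = ?of (fs ! nat z)"
    using f[of 0] f[of 1] f[of "nat z"] z by simp_all
  have slopes: "?of (fs ! 1 - fs ! 0) = ?of c" "?of (fs ! nat z - fs ! 0) = ?of (b * z)"
    "?of (fs ! nat z - fs ! 1) = ?of (a * (z - 1))"
    by (rule eq; use assms in simp)+
  have "?of z \<noteq> 0" "?of z \<noteq> 1"
    using z of_int_mod_ring_eq_iff[of z 0, where 'a = 'a]
      of_int_mod_ring_eq_iff[of z 1, where 'a = 'a]
    by auto
  then show ?thesis
    using slopes by (intro slopes_occurI[OF \<open>orthomorphism f\<close>, of 0 1 "?of z"]) (auto simp: points)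
qed

lemma resolved_if_two_failures:
  assumes "slope_ok qs T a" "(b, c) \<in> set (failures qs a)" "(c, b) \<in> set (failures qs a)" "b < c"
  shows "(c, a) \<notin> set (failures qs b) \<or> (a, b, c) \<in> set T \<or> (a, c, b) \<in> set T"
proof -
  have "(b, c) \<in> set (two_sided (failures qs a))"
    using assms(2-4) unfolding two_sided_def by force
  then show ?thesis using assms(1) unfolding slope_ok_def list_all_iff by auto
qed

lemma slopes_occur_if_slope_ok:
  fixes T :: "(int \<times> int \<times> int) list"
  assumes card: "p = int (CARD('a::prime_card))" "p > 2"
    and ok: "slope_ok (quadrants [2..p - 1] (square_table p)) T a"
    and table: "\<And>a b c. (a, b, c) \<in> set T \<Longrightarrow>
      slopes_occur (of_int a :: 'a mod_ring) (of_int b) (of_int c)"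
    and bounds: "{a, b, c} \<subseteq> {2..<p}" "distinct [a, b, c]" and less: "b < c"
  shows "slopes_occur (of_int a :: 'a mod_ring) (of_int b) (of_int c)"
proof -
  define qs where "qs = quadrants [2..p - 1] (square_table p)"
  note occur = slopes_occur_if_not_failure[OF card, folded qs_def]
  consider "(b, c) \<notin> set (failures qs a)" | "(c, b) \<notin> set (failures qs a)"
    | "(c, a) \<notin> set (failures qs b)" | "(a, b, c) \<in> set T" | "(a, c, b) \<in> set T"
    using resolved_if_two_failures[OF ok _ _ less] unfolding qs_def by blast
  then show ?thesis
  proof cases
    case 1
    then show ?thesis using occur[of a b c] bounds by simp
  next
    case 2
    then show ?thesis using occur[of a c b] bounds by (auto intro: slopes_occur_swap23)
  next
    case 3
    then have "slopes_occur (of_int b :: 'a mod_ring) (of_int c) (of_int a)"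
      using occur[of b c a] bounds by auto
    then show ?thesis using slopes_occur_swap12 slopes_occur_swap23 by blast
  next
    case 4
    then show ?thesis by (rule table)
  next
    case 5
    then show ?thesis using table slopes_occur_swap23 by blast
  qed
qed

lemma slopes_occur_if_valid_certificate:
  assumes card: "p = int (CARD('a::prime_card))" "p > 2" and valid: "valid_certificate (p, A, E)"
    and representative: "a \<in> fst ` set A" and bounds: "{b, c} \<subseteq> {2..<p}" "distinct [a, b, c]"
  shows "slopes_occur (of_int a :: 'a mod_ring) (of_int b) (of_int c)"
proof -
  define T where "T = map (\<lambda>(a, b, c, _). (a, b, c)) E"
  have "\<forall>x\<in>fst ` set A. slope_ok (quadrants [2..p - 1] (square_table p)) T x"
    using valid by (simp add: slopes_ok_def list_all_iff T_def)
  then have ok: "slope_ok (quadrants [2..p - 1] (square_table p)) T a" using representative by blast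
  have table: "slopes_occur (of_int x :: 'a mod_ring) (of_int y) (of_int z)"
    if "(x, y, z) \<in> set T" for x y z
    using that valid card(1) slopes_occur_if_table_ok[where 'a = 'a]
    by (auto simp: T_def list_all_iff simp del: table_ok.simps)
  have "a \<in> {2..<p}" using valid representative by (auto simp: list_all_iff)
  show ?thesis
  proof (cases "b < c")
    case True
    then show ?thesis
      using bounds \<open>a \<in> {2..<p}\<close> by (intro slopes_occur_if_slope_ok[OF card ok table]) auto
  next
    case False
    then have "slopes_occur (of_int a :: 'a mod_ring) (of_int c) (of_int b)"
      using bounds \<open>a \<in> {2..<p}\<close> by (intro slopes_occur_if_slope_ok[OF card ok table]) auto
    then show ?thesis by (rule slopes_occur_swap23)
  qed
qed

lemma mod_ring_eq_of_int:
  fixes z :: "'a::prime_card mod_ring"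
  assumes "z \<noteq> 0" "z \<noteq> 1"
  obtains k where "2 \<le> k" "k < int (CARD('a))" "z = of_int k"
proof -
  obtain i where i: "i < CARD('a)" "z = of_nat i" using surj_of_nat_mod_ring by blast
  then have "i \<noteq> 0" "i \<noteq> 1" using assms by (metis of_nat_0, metis of_nat_1)
  then show ?thesis using i by (intro that[of "int i"]) auto
qed

lemma universal_slope_if_valid_certificate:
  fixes z :: "'a::prime_card mod_ring"
  assumes card: "p = int (CARD('a))" "p > 2" and valid: "valid_certificate (p, A, E)"
  shows "universal_slope z"
proof (cases "z = 0 \<or> z = 1")
  case True
  then show ?thesis by (auto simp: universal_slope_def)
next
  case False
  let ?of = "of_int :: int \<Rightarrow> 'a mod_ring"
  have eq: "?of k = ?of l" if "k mod p = l mod p" for k l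
    using that unfolding of_int_mod_ring_eq_iff card(1) .
  have representative: "universal_slope (?of a)" if "a \<in> fst ` set A" for a
    unfolding universal_slope_def
  proof (intro allI impI)
    fix b c assume distinct: "distinct [0, 1, ?of a, b, c]"
    then obtain k l where "2 \<le> k" "k < p" "b = ?of k" "2 \<le> l" "l < p" "c = ?of l"
      using mod_ring_eq_of_int[of b] mod_ring_eq_of_int[of c] card(1)
      by (metis distinct_length_2_or_more)
    moreover from this distinct have "distinct [a, k, l]" by auto
    ultimately show "slopes_occur (?of a) b c"
      using slopes_occur_if_valid_certificate[OF card valid that, of k l] by simp
  qed
  obtain k where k: "2 \<le> k" "k < p" "z = ?of k"
    using mod_ring_eq_of_int[of z] False card(1) by metis
  then obtain a a' a'' where entry: "(a, a', a'') \<in> set A"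
    and orbit: "k \<in> set (slope_orbit p (a, a', a''))"
    using valid by (force simp del: slope_orbit.simps)
  have "a * a' mod p = 1 mod p" "(1 - a) * a'' mod p = 1 mod p"
    using valid entry card(2) by (auto simp: list_all_iff)
  then have inverse: "?of a * ?of a' = 1" "(1 - ?of a) * ?of a'' = 1"
    using eq[of "a * a'" 1] eq[of "(1 - a) * a''" 1] by simp_all
  have universal: "universal_slope (?of a)" using entry by (intro representative) force
  have "universal_slope (?of a')" "universal_slope (?of a'')"
    using universal_slope_inverse[OF universal inverse(1)]
      universal_slope_inverse[OF universal_slope_one_minus[OF universal] inverse(2)] by blast+
  moreover have "?of (p + 1 - l) = 1 - ?of l" for l
  proof -
    have "?of (p + 1 - l) = ?of (1 - l)" by (rule eq) (metis add_diff_eq mod_add_self1)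
    then show ?thesis by simp
  qed
  ultimately show ?thesis
    using orbit universal universal_slope_one_minus unfolding k(3) by fastforce
qed

abbreviation certificates :: "certificate list" where
  "certificates \<equiv> certificates_below_103 @ certificates_from_103"

lemma certificates_valid:
  "list_all valid_certificate certificates_below_103"
  "list_all valid_certificate certificates_from_103"
  by code_simp+

lemma prime_below_149_has_certificate:
  fixes p :: nat
  assumes "prime p" "7 < p" "p < 149"
  shows "\<exists>A E. (int p, A, E) \<in> set certificates"
proof -
  let ?sieve = "\<lambda>n. \<not> 2 dvd n \<and> \<not> 3 dvd n \<and> \<not> 5 dvd n \<and> \<not> 7 dvd n \<and> (n = 11 \<or> \<not> 11 dvd n)"
  have "\<not> q dvd p" if "q > 1" "q \<noteq> p" for q
    using that assms(1) prime_nat_iff by auto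
  from this[of 2] this[of 3] this[of 5] this[of 7] this[of 11] have "?sieve p"
    using assms(2) by auto
  then have "p \<in> set (filter ?sieve [8..<149])"
    using assms(2,3) unfolding set_filter set_upt by (intro CollectI conjI) simp_all
  also have "filter ?sieve [8..<149] = map (nat \<circ> fst) certificates"
    by (simp add: certificates_below_103_def certificates_from_103_def)
  finally obtain C where "C \<in> set certificates" "p = nat (fst C)" by auto
  moreover have "\<forall>C\<in>set certificates. 0 \<le> fst C"
    by (simp add: certificates_below_103_def certificates_from_103_def)
  ultimately have "(int p, snd C) \<in> set certificates" by (metis int_nat_eq prod.collapse)
  then show ?thesis by (cases "snd C") auto
qed

theorem universal_slope_mod_ring:
  fixes a :: "'a::prime_card mod_ring"
  assumes "CARD('a) > 7"
  shows "universal_slope a"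
proof (cases "CARD('a) \<ge> 149")
  case True
  have "odd (CARD('a))" using assms prime_card[where 'a = 'a] prime_odd_nat[of "CARD('a)"] by simp
  then show ?thesis using True by (intro universal_slope_large[where n = 1]) simp_all
next
  case False
  then obtain A E where "(int (CARD('a)), A, E) \<in> set certificates"
    using prime_below_149_has_certificate[OF prime_card assms] by auto
  then have "valid_certificate (int (CARD('a)), A, E)"
    using certificates_valid by (auto simp: list_all_iff simp del: valid_certificate.simps)
  then show ?thesis using assms by (intro universal_slope_if_valid_certificate) auto
qed

section \<open>Diagonally cyclic latin squares\<close>

definition cyclic_diagonal :: "nat \<Rightarrow> nat \<Rightarrow> nat \<Rightarrow> (nat \<times> nat \<times> nat) set" where
  "cyclic_diagonal p c s = {(i, (c + i) mod p, (s + i) mod p) | i. i < p}"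

definition orthomorphism_square ::
  "('a::prime_card mod_ring \<Rightarrow> 'a mod_ring) \<Rightarrow> (nat \<times> nat \<times> nat) set" where
  "orthomorphism_square f = {(i, j, k). i < CARD('a) \<and> j < CARD('a) \<and> k < CARD('a) \<and>
     of_nat k - of_nat i = f (of_nat j - of_nat i)}"

lemma of_nat_mod_card: "of_nat (n mod CARD('a)) = (of_nat n :: 'a::prime_card mod_ring)"
  using of_nat_mod_CHAR[of n, where 'a = "'a mod_ring"] by simp

lemma of_nat_eq_iff_less_card:
  assumes "i < CARD('a)" "j < CARD('a)"
  shows "(of_nat i :: 'a::prime_card mod_ring) = of_nat j \<longleftrightarrow> i = j"
  using assms by (simp add: of_nat_eq_iff_cong_CHAR cong_def)

lemma partial_latin_square_orthomorphism_square:
  fixes f :: "'a::prime_card mod_ring \<Rightarrow> 'a mod_ring"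
  assumes "orthomorphism f"
  shows "partial_latin_square (CARD('a)) (orthomorphism_square f)"
proof -
  have inj: "inj f" "inj (\<lambda>u. f u - u)"
    using assms by (auto simp: orthomorphism_def bij_is_inj)
  have cell: "f (of_nat t - of_nat r) = of_nat u - of_nat r"
    if "(r, t, u) \<in> orthomorphism_square f" for r t u
    using that by (simp add: orthomorphism_square_def)
  have less: "r < CARD('a)" "t < CARD('a)" "u < CARD('a)"
    if "(r, t, u) \<in> orthomorphism_square f" for r t u
    using that by (simp_all add: orthomorphism_square_def)
  have symbol_eq: "u = u'"
    if "(r, t, u) \<in> orthomorphism_square f" "(r, t, u') \<in> orthomorphism_square f" for r t u u'
  proof -
    have "(of_nat u :: 'a mod_ring) = of_nat u'" using that[THEN cell] by (metis diff_add_cancel)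
    then show ?thesis using that[THEN less(3)] by (simp add: of_nat_eq_iff_less_card)
  qed
  have column_eq: "t = t'"
    if "(r, t, u) \<in> orthomorphism_square f" "(r, t', u) \<in> orthomorphism_square f" for r t t' u
  proof -
    have "of_nat t - of_nat r = (of_nat t' - of_nat r :: 'a mod_ring)"
      using that[THEN cell] injD[OF inj(1)] by metis
    then show ?thesis using that[THEN less(2)] by (simp add: of_nat_eq_iff_less_card)
  qed
  have row_eq: "r = r'"
    if "(r, t, u) \<in> orthomorphism_square f" "(r', t, u) \<in> orthomorphism_square f" for r r' t u
  proof -
    have "f (of_nat t - of_nat r) - (of_nat t - of_nat r)
        = f (of_nat t - of_nat r') - (of_nat t - of_nat r')"
      using that[THEN cell] by simp
    then have "of_nat t - of_nat r = (of_nat t - of_nat r' :: 'a mod_ring)"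
      using injD[OF inj(2)] by blast
    then show ?thesis using that[THEN less(1)] by (simp add: of_nat_eq_iff_less_card)
  qed
  have "orthomorphism_square f \<subseteq> {..<CARD('a)} \<times> {..<CARD('a)} \<times> {..<CARD('a)}"
    by (auto simp: orthomorphism_square_def)
  then show ?thesis
    unfolding partial_latin_square_def using column_eq row_eq symbol_eq by fast
qed

lemma latin_square_orthomorphism_square:
  fixes f :: "'a::prime_card mod_ring \<Rightarrow> 'a mod_ring"
  assumes "orthomorphism f"
  shows "latin_square (CARD('a)) (orthomorphism_square f)"
proof -
  have "\<exists>u. (r, t, u) \<in> orthomorphism_square f" if "r < CARD('a)" "t < CARD('a)" for r t
  proof -
    obtain u where "u < CARD('a)" "of_nat r + f (of_nat t - of_nat r) = of_nat u"
      using surj_of_nat_mod_ring by blast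
    then have "(r, t, u) \<in> orthomorphism_square f"
      using that by (simp add: orthomorphism_square_def diff_eq_eq add.commute)
    then show ?thesis ..
  qed
  then show ?thesis
    unfolding latin_square_def using partial_latin_square_orthomorphism_square[OF assms] by blast
qed

lemma diagonally_cyclic_orthomorphism_square:
  fixes f :: "'a::prime_card mod_ring \<Rightarrow> 'a mod_ring"
  shows "diagonally_cyclic (CARD('a)) (orthomorphism_square f)"
  unfolding diagonally_cyclic_def orthomorphism_square_def by (auto simp: of_nat_mod_card)

lemma cyclic_diagonal_subset_orthomorphism_square:
  fixes f :: "'a::prime_card mod_ring \<Rightarrow> 'a mod_ring"
  assumes "f (of_nat c) = of_nat s"
  shows "cyclic_diagonal (CARD('a)) c s \<subseteq> orthomorphism_square f"
  using assms unfolding cyclic_diagonal_def orthomorphism_square_def by (auto simp: of_nat_mod_card)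

lemma differences_distinct:
  assumes P: "partial_latin_square (CARD('a)) P"
      "cyclic_diagonal (CARD('a)) c s \<subseteq> P" "cyclic_diagonal (CARD('a)) c' s' \<subseteq> P"
    and columns: "c < CARD('a)" "c' < CARD('a)" "c \<noteq> c'"
  shows "(of_nat s - of_nat c :: 'a::prime_card mod_ring) \<noteq> of_nat s' - of_nat c'"
proof
  let ?p = "CARD('a)"
  assume "(of_nat s - of_nat c :: 'a mod_ring) = of_nat s' - of_nat c'"
  then have "(of_nat (s + c') :: 'a mod_ring) = of_nat (s' + c)" by (simp add: algebra_simps)
  then have "(s + c') mod ?p = (s' + c) mod ?p"
    by (simp only: of_nat_eq_iff_cong_CHAR) (simp add: cong_def)
  moreover have "(c', (c + c') mod ?p, (s + c') mod ?p) \<in> P"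
    "(c, (c' + c) mod ?p, (s' + c) mod ?p) \<in> P"
    using P(2,3) columns unfolding cyclic_diagonal_def by blast+
  ultimately have "c' = c"
    using P(1) unfolding partial_latin_square_def by (fastforce simp: add.commute)
  then show False using columns by simp
qed

definition diagonals_completable :: "nat \<Rightarrow> bool" where
  "diagonals_completable p \<longleftrightarrow> (\<forall>c c' c'' s s' s''. {c, c', c'', s, s', s''} \<subseteq> {..<p} \<longrightarrow>
     distinct [c, c', c''] \<longrightarrow> distinct [s, s', s''] \<longrightarrow>
     partial_latin_square p
       (cyclic_diagonal p c s \<union> cyclic_diagonal p c' s' \<union> cyclic_diagonal p c'' s'') \<longrightarrow>
     (\<exists>L. latin_square p L \<and> diagonally_cyclic p L \<and>
        cyclic_diagonal p c s \<union> cyclic_diagonal p c' s' \<union> cyclic_diagonal p c'' s'' \<subseteq> L))"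

lemma diagonals_completable_card:
  assumes universal: "\<And>a :: 'a::prime_card mod_ring. universal_slope a"
  shows "diagonals_completable (CARD('a))"
  unfolding diagonals_completable_def
proof (intro allI impI)
  let ?p = "CARD('a)" and ?of = "of_nat :: nat \<Rightarrow> 'a mod_ring"
  fix c c' c'' s s' s'' :: nat
  let ?P = "cyclic_diagonal ?p c s \<union> cyclic_diagonal ?p c' s' \<union> cyclic_diagonal ?p c'' s''"
  assume less: "{c, c', c'', s, s', s''} \<subseteq> {..<?p}"
    and distinct: "distinct [c, c', c'']" "distinct [s, s', s'']"
    and P: "partial_latin_square ?p ?P"
  have "\<exists>f. orthomorphism f \<and> f (?of c) = ?of s \<and> f (?of c') = ?of s' \<and> f (?of c'') = ?of s''"
  proof (rule orthomorphism_extension[OF universal])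
    show "distinct [?of c, ?of c', ?of c'']" "distinct [?of s, ?of s', ?of s'']"
      using less distinct by (simp_all add: of_nat_eq_iff_less_card)
    show "distinct [?of s - ?of c, ?of s' - ?of c', ?of s'' - ?of c'']"
      using differences_distinct[OF P, of c s c' s'] differences_distinct[OF P, of c s c'' s'']
        differences_distinct[OF P, of c' s' c'' s''] less distinct by auto
  qed
  then obtain f where "orthomorphism f" "f (?of c) = ?of s" "f (?of c') = ?of s'"
    "f (?of c'') = ?of s''"
    by blast
  then show "\<exists>L. latin_square ?p L \<and> diagonally_cyclic ?p L \<and> ?P \<subseteq> L"
    using latin_square_orthomorphism_square diagonally_cyclic_orthomorphism_square
      cyclic_diagonal_subset_orthomorphism_square
      by (intro exI[of _ "orthomorphism_square f"]) blast
qed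

text \<open>
  The field of order \<open>p\<close> is needed as a type, but a type cannot depend on the variable \<open>p\<close>. A type
  is therefore built for one fixed prime that is a counterexample if there is one; proving the claim
  for this prime proves it for all.
\<close>

definition test_prime :: nat where
  "test_prime = (SOME p. prime p \<and> 7 < p \<and>
     (diagonals_completable p \<longrightarrow> (\<forall>q. prime q \<longrightarrow> 7 < q \<longrightarrow> diagonals_completable q)))"

lemma test_prime: "prime test_prime" "7 < test_prime"
  "diagonals_completable test_prime \<Longrightarrow> prime q \<Longrightarrow> 7 < q \<Longrightarrow> diagonals_completable q"
proof -
  have "\<exists>p. prime p \<and> 7 < p \<and>
      (diagonals_completable p \<longrightarrow> (\<forall>q. prime q \<longrightarrow> 7 < q \<longrightarrow> diagonals_completable q))"
  proof (cases "\<exists>p. prime p \<and> 7 < p \<and> \<not> diagonals_completable p")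
    case True
    then show ?thesis by blast
  next
    case False
    then show ?thesis by (intro exI[of _ 11]) auto
  qed
  from someI_ex[OF this, folded test_prime_def]
  show "prime test_prime" "7 < test_prime"
    "diagonals_completable test_prime \<Longrightarrow> prime q \<Longrightarrow> 7 < q \<Longrightarrow> diagonals_completable q" by blast+
qed

typedef test_index = "{..<test_prime}"
  using test_prime(2) by (intro exI[of _ 0]) simp

lemma card_test_index: "CARD(test_index) = test_prime"
  using type_definition.card[OF type_definition_test_index] by simp

instance test_index :: prime_card
  by standard (simp add: card_test_index test_prime(1))

theorem diagonals_completable_prime:
  assumes "prime p" "p > 7"
  shows "diagonals_completable p"
proof -
  have "universal_slope a" for a :: "test_index mod_ring"
    by (rule universal_slope_mod_ring) (simp add: card_test_index test_prime(2))
  then have "diagonals_completable test_prime"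
    using diagonals_completable_card[where 'a = test_index] by (simp add: card_test_index)
  then show ?thesis using assms by (rule test_prime(3))
qed

theorem theorem8:
  fixes p c c' c'' s s' s'' :: nat
    and P :: "(nat \<times> nat \<times> nat) set"
  assumes "prime p" and "p > 7"
    and "c < p" and "c' < p" and "c'' < p"
    and "s < p" and "s' < p" and "s'' < p"
    and "c \<noteq> c'" and "c \<noteq> c''" and "c' \<noteq> c''"
    and "s \<noteq> s'" and "s \<noteq> s''" and "s' \<noteq> s''"
    and "P = {(i, (c + i) mod p, (s + i) mod p) | i. i < p}
           \<union> {(i, (c' + i) mod p, (s' + i) mod p) | i. i < p}
           \<union> {(i, (c'' + i) mod p, (s'' + i) mod p) | i. i < p}"
    and "partial_latin_square p P"
  shows "\<exists>L. latin_square p L \<and> diagonally_cyclic p L \<and> P \<subseteq> L"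
proof -
  have "P = cyclic_diagonal p c s \<union> cyclic_diagonal p c' s' \<union> cyclic_diagonal p c'' s''"
    unfolding cyclic_diagonal_def by (rule assms)
  moreover have "{c, c', c'', s, s', s''} \<subseteq> {..<p}" "distinct [c, c', c'']" "distinct [s, s', s'']"
    using assms by auto
  ultimately show ?thesis
    using diagonals_completable_prime[OF \<open>prime p\<close> \<open>p > 7\<close>] \<open>partial_latin_square p P\<close>
    unfolding diagonals_completable_def by blast
qed

end
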